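(* Let $\Phi$ be a quantum channel from $\mathcal{H}$ to $\mathcal{K}$ with Stinespring form $\Phi(X)=\operatorname{tr}_{\mathcal{B}}U(|0\rangle\langle0|\otimes X)U^*$, $|0\rangle\in\mathcal{A}$, $U$ unitary from $\mathcal{A}\otimes\mathcal{H}$ to $\mathcal{K}\otimes\mathcal{B}$, and let $\Phi'$ be the mixed-unitary channel from $\mathcal{A}\otimes\mathcal{H}$ to $\mathcal{K}\otimes\mathcal{B}$ constructed below. Then for every $p\in[1,\infty]$, $\nu_p(\Phi)\le \nu_p(\Phi')/\|\mathbb{1}_{\mathcal{B}}/\dim\mathcal{B}\|_p\le\nu_p(\Phi)+2\dim\mathcal{B}/\dim\mathcal{A}$.
   Context: $\|A\|_p=(\operatorname{tr}|A|^p)^{1/p}$ (Schatten $p$-norm; $p=\infty$ the operator norm) and $\nu_p(\Phi)=\max_\rho\|\Phi(\rho)\|_p$ over input density operators. Construction: let $S_0=|0\rangle\otimes\mathcal{H}$ and $S_0^\perp$ its orthogonal complement in $\mathcal{A}\otimes\mathcal{H}$. $D_{S_0}(\rho)=\tfrac12(V\rho V^*+\rho)$ with $V$ the identity on $S_0$ and $-1$ on $S_0^\perp$. $M(\rho)=\frac1{e^2}\sum_{a,b=0}^{e-1}(\mathbb{1}_{S_0}\oplus W_{a,b})\rho(\mathbb{1}_{S_0}\oplus W_{a,b})^*$, $e=\dim S_0^\perp$, $W_{a,b}=X^aZ^b$ the discrete Weyl operators on $S_0^\perp$ ($X|j\rangle=|j+1\bmod e\rangle$, $Z|j\rangle=e^{2\pi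 ij/e}|j\rangle$). $N_{\mathcal{B}}(Y)=\operatorname{tr}_{\mathcal{B}}(Y)\otimes\mathbb{1}_{\mathcal{B}}/\dim\mathcal{B}$. Then $\Phi'(\rho)=N_{\mathcal{B}}(U[(M\circ D_{S_0})(\rho)]U^* )$. *)

theory Defs
  imports "Jordan_Normal_Form.Jordan_Normal_Form" "Jordan_Normal_Form.Schur_Decomposition" "HOL-Library.Extended_Real"
begin

(* Finite-dimensional Hilbert spaces are C^d; operators are complex matrices.
   Tensor products use the Kronecker index convention: for A (x) H with dim A = a,
   dim H = h, basis vector |alpha> (x) |eta> has index alpha*h + eta. *)

definition conj_tr :: "complex mat \<Rightarrow> complex mat" where
  "conj_tr A = mat_adjoint A"

definition unitary_mat :: "nat \<Rightarrow> complex mat \<Rightarrow> bool" where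
  "unitary_mat n U \<longleftrightarrow> U \<in> carrier_mat n n \<and> conj_tr U * U = 1\<^sub>m n \<and> U * conj_tr U = 1\<^sub>m n"

definition density_op :: "nat \<Rightarrow> complex mat \<Rightarrow> bool" where
  "density_op n \<rho> \<longleftrightarrow> \<rho> \<in> carrier_mat n n \<and> conj_tr \<rho> = \<rho> \<and>
     (\<forall>v \<in> carrier_vec n. 0 \<le> Re (\<Sum>i<n. cnj (v $ i) * (\<rho> *\<^sub>v v) $ i)) \<and>
     (\<Sum>i<n. \<rho> $$ (i,i)) = 1"

definition eigvals_list :: "complex mat \<Rightarrow> complex list" where
  "eigvals_list A = (SOME as. char_poly A = (\<Prod>a\<leftarrow>as. [:- a, 1:]))"

definition sing_vals :: "complex mat \<Rightarrow> real list" where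
  "sing_vals A = map (\<lambda>z. sqrt (Re z)) (eigvals_list (conj_tr A * A))"

definition schatten :: "ereal \<Rightarrow> complex mat \<Rightarrow> real" where
  "schatten p A = (if p = \<infinity> then Max (insert 0 (set (sing_vals A)))
     else (\<Sum>s\<leftarrow>sing_vals A. s powr real_of_ereal p) powr (1 / real_of_ereal p))"

definition nu :: "ereal \<Rightarrow> nat \<Rightarrow> (complex mat \<Rightarrow> complex mat) \<Rightarrow> real" where
  "nu p n \<Phi> = Sup ((\<lambda>\<rho>. schatten p (\<Phi> \<rho>)) ` {\<rho>. density_op n \<rho>})"

definition ptrace_B :: "nat \<Rightarrow> nat \<Rightarrow> complex mat \<Rightarrow> complex mat" where
  "ptrace_B k b Y = mat k k (\<lambda>(i,j). \<Sum>\<beta><b. Y $$ (i*b+\<beta>, j*b+\<beta>))"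

(* N_B(Y) = tr_B(Y) (x) 1_B / dim B *)
definition N_B :: "nat \<Rightarrow> nat \<Rightarrow> complex mat \<Rightarrow> complex mat" where
  "N_B k b Y = mat (k*b) (k*b) (\<lambda>(i,j).
     if i mod b = j mod b then ptrace_B k b Y $$ (i div b, j div b) / of_nat b else 0)"

(* |0><0| (x) X on A (x) H, with |0> the first basis vector of A *)
definition embed0 :: "nat \<Rightarrow> nat \<Rightarrow> complex mat \<Rightarrow> complex mat" where
  "embed0 a h X = mat (a*h) (a*h) (\<lambda>(i,j). if i < h \<and> j < h then X $$ (i,j) else 0)"

definition stine :: "nat \<Rightarrow> nat \<Rightarrow> nat \<Rightarrow> nat \<Rightarrow> complex mat \<Rightarrow> complex mat \<Rightarrow> complex mat" where
  "stine a h k b U X = ptrace_B k b (U * embed0 a h X * conj_tr U)"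

(* S_0 = |0> (x) H = span of basis vectors with index < h; V = 1 on S_0, -1 on S_0^perp *)
definition V_refl :: "nat \<Rightarrow> nat \<Rightarrow> complex mat" where
  "V_refl a h = mat (a*h) (a*h) (\<lambda>(i,j). if i = j then (if i < h then 1 else -1) else 0)"

definition D_S0 :: "nat \<Rightarrow> nat \<Rightarrow> complex mat \<Rightarrow> complex mat" where
  "D_S0 a h \<rho> = (1/2 :: complex) \<cdot>\<^sub>m (V_refl a h * \<rho> * conj_tr (V_refl a h) + \<rho>)"

definition shiftX :: "nat \<Rightarrow> complex mat" where
  "shiftX e = mat e e (\<lambda>(i,j). if i = (j + 1) mod e then 1 else 0)"

definition clockZ :: "nat \<Rightarrow> complex mat" where
  "clockZ e = mat e e (\<lambda>(i,j). if i = j then exp (2 * pi * \<i> * of_nat j / of_nat e) else 0)"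

definition weyl :: "nat \<Rightarrow> nat \<Rightarrow> nat \<Rightarrow> complex mat" where
  "weyl e x z = (shiftX e ^\<^sub>m x) * (clockZ e ^\<^sub>m z)"

(* 1_{S_0} (+) W_{x,z}, S_0^perp having basis the vectors with index h, ..., a*h-1 (in order) *)
definition blockW :: "nat \<Rightarrow> nat \<Rightarrow> nat \<Rightarrow> nat \<Rightarrow> complex mat" where
  "blockW a h x z = (let e = a*h - h in mat (a*h) (a*h) (\<lambda>(i,j).
     if i < h \<and> j < h then (if i = j then 1 else 0)
     else if h \<le> i \<and> h \<le> j then weyl e x z $$ (i - h, j - h) else 0))"

definition M_twirl :: "nat \<Rightarrow> nat \<Rightarrow> complex mat \<Rightarrow> complex mat" where
  "M_twirl a h \<rho> = (let e = a*h - h in mat (a*h) (a*h) (\<lambda>(i,j).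
     (1 / of_nat (e^2)) * (\<Sum>x<e. \<Sum>z<e.
        (blockW a h x z * \<rho> * conj_tr (blockW a h x z)) $$ (i,j))))"

definition Phi' :: "nat \<Rightarrow> nat \<Rightarrow> nat \<Rightarrow> nat \<Rightarrow> complex mat \<Rightarrow> complex mat \<Rightarrow> complex mat" where
  "Phi' a h k b U \<rho> = N_B k b (U * M_twirl a h (D_S0 a h \<rho>) * conj_tr U)"

end

theory Submission
  imports Defs "Jordan_Normal_Form.Spectral_Radius"
begin

text \<open>
  Write \<open>T\<close> for conjugation by \<open>U\<close> followed by the partial trace over \<open>\<B>\<close>. The twirl turns \<open>\<rho>\<close> into
  \<open>\<rho>\<^sub>0\<^sub>0 \<oplus> (q / e) 1 = (1 - q) |0><0| \<otimes> \<sigma> + q \<tau>\<close>, where \<open>\<tau>\<close> is maximally mixed on the complement of \<open>S\<^sub>0\<close>, and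
  \<open>\<Phi>' \<rho>\<close> is \<open>T\<close> of that state tensored with \<open>1 / b\<close>. As the Schatten norm is multiplicative on tensor
  products, \<open>\<nu>\<^sub>p \<Phi>'\<close> divided by the norm of \<open>1 / b\<close> is the supremum of the norms of these \<open>T\<close>-images. States with
  \<open>q = 0\<close> give the lower bound. For the upper bound, quasi-convexity of the norm on positive matrices
  (Peierls' inequality) reduces the claim to the norm of \<open>T \<tau>\<close>. Since \<open>T 1 = b 1\<close>, we have \<open>T \<tau> \<le> (b / e) 1\<close>, so that
  its norm is at most \<open>a / (a - 1)\<close> times the norm of \<open>1 / k\<close>. The latter is at most \<open>1\<close>, and at most
  \<open>\<nu>\<^sub>p \<Phi>\<close> because \<open>1 / k\<close> minimizes the norm among states.
\<close>

subsection \<open>Finite-dimensional \<open>\<ell>\<^sup>p\<close> norms\<close>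

definition lp_norm :: "ereal \<Rightarrow> nat \<Rightarrow> (nat \<Rightarrow> real) \<Rightarrow> real" where
  "lp_norm p n d = (if p = \<infinity> then Max (insert 0 (d ` {..<n}))
     else (\<Sum>i<n. d i powr real_of_ereal p) powr (1 / real_of_ereal p))"

lemma ereal_ge_one_cases:
  assumes "1 \<le> (p::ereal)"
  obtains "p = \<infinity>" | r where "p = ereal r" "1 \<le> r"
  using assms by (cases p) auto

lemma lp_norm_PInf_le_iff: "lp_norm \<infinity> n d \<le> c \<longleftrightarrow> 0 \<le> c \<and> (\<forall>i<n. d i \<le> c)"
  by (auto simp: lp_norm_def)

lemma le_lp_norm_PInf: "i < n \<Longrightarrow> d i \<le> lp_norm \<infinity> n d"
  by (auto simp: lp_norm_def)

lemma lp_norm_nonneg: "0 \<le> lp_norm p n d"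
  by (auto simp: lp_norm_def)

lemma lp_norm_ereal: "lp_norm (ereal r) n d = (\<Sum>i<n. d i powr r) powr (1 / r)"
  by (simp add: lp_norm_def)

lemma lp_norm_mono:
  assumes "1 \<le> p" and "\<And>i. i < n \<Longrightarrow> 0 \<le> c i" and "\<And>i. i < n \<Longrightarrow> c i \<le> d i"
  shows "lp_norm p n c \<le> lp_norm p n d"
  using \<open>1 \<le> p\<close>
proof (cases rule: ereal_ge_one_cases)
  case 1
  then show ?thesis
    using assms(3) le_lp_norm_PInf[of _ n d] by (fastforce simp: lp_norm_PInf_le_iff lp_norm_nonneg)
next
  case (2 r)
  have "(\<Sum>i<n. c i powr r) \<le> (\<Sum>i<n. d i powr r)"
    using assms 2 by (intro sum_mono powr_mono2) auto
  then show ?thesis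
    using 2 by (simp add: lp_norm_ereal powr_mono2 sum_nonneg)
qed

lemma lp_norm_cmult:
  assumes "1 \<le> p" and "0 \<le> c" and "\<And>i. i < n \<Longrightarrow> 0 \<le> d i"
  shows "lp_norm p n (\<lambda>i. c * d i) = c * lp_norm p n d"
  using \<open>1 \<le> p\<close>
proof (cases rule: ereal_ge_one_cases)
  case 1
  have "mono ((*) c)" using \<open>0 \<le> c\<close> by (intro monoI mult_left_mono)
  then have "c * Max (insert 0 (d ` {..<n})) = Max ((*) c ` insert 0 (d ` {..<n}))"
    by (intro mono_Max_commute) auto
  also have "(*) c ` insert 0 (d ` {..<n}) = insert 0 ((\<lambda>i. c * d i) ` {..<n})"
    by (auto simp: image_image)
  finally show ?thesis using 1 by (simp add: lp_norm_def)
next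
  case (2 r)
  have "(\<Sum>i<n. (c * d i) powr r) = c powr r * (\<Sum>i<n. d i powr r)"
    using assms by (simp add: powr_mult sum_distrib_left)
  then show ?thesis
    using assms 2 by (simp add: lp_norm_ereal powr_mult sum_nonneg powr_powr)
qed

lemma powr_ge_tangent:
  fixes t r :: real
  assumes "0 \<le> t" "1 \<le> r"
  shows "1 + r * (t - 1) \<le> t powr r"
proof (cases "0 < 1 + r * (t - 1)")
  case False
  then show ?thesis by (meson linorder_not_le order.trans order_less_imp_le powr_ge_zero)
next
  case u: True
  have "t \<noteq> 0" using u assms by auto
  with assms have t: "0 < t" by simp
  let ?u = "1 + r * (t - 1)"
  have "ln (?u / t) \<le> ?u / t - 1" "ln (1 / t) \<le> 1 / t - 1"
    using t u by (auto intro!: ln_le_minus_one)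
  moreover have "(r - 1) * ln (1 / t) \<le> (r - 1) * (1 / t - 1)"
    using calculation(2) assms by (intro mult_left_mono) auto
  moreover have "?u / t - 1 + (r - 1) * (1 / t - 1) = 0"
    using t by (simp add: field_simps)
  ultimately have "ln (?u / t) + (r - 1) * ln (1 / t) \<le> 0" by linarith
  then have "ln ?u \<le> r * ln t"
    using t u by (simp add: ln_div algebra_simps)
  then have "exp (ln ?u) \<le> exp (r * ln t)" by simp
  then show ?thesis using t u by (simp add: powr_def)
qed

lemma powr_jensen:
  fixes s d :: "'a \<Rightarrow> real"
  assumes "1 \<le> r" and "\<And>j. j \<in> S \<Longrightarrow> 0 \<le> s j" and "sum s S = 1" and "\<And>j. j \<in> S \<Longrightarrow> 0 \<le> d j"
  shows "(\<Sum>j\<in>S. s j * d j) powr r \<le> (\<Sum>j\<in>S. s j * d j powr r)"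
proof (cases "(\<Sum>j\<in>S. s j * d j) = 0")
  case True
  have "0 \<le> (\<Sum>j\<in>S. s j * d j powr r)"
    using assms by (intro sum_nonneg mult_nonneg_nonneg) auto
  then show ?thesis using True by simp
next
  case False
  define m where "m = (\<Sum>j\<in>S. s j * d j)"
  have "0 \<le> m" unfolding m_def using assms by (intro sum_nonneg mult_nonneg_nonneg) auto
  with False have m: "0 < m" by (simp add: m_def)
  have "m powr r = m powr r * (\<Sum>j\<in>S. s j * (1 + r * (d j / m - 1)))"
  proof -
    have "(\<Sum>j\<in>S. s j * (1 + r * (d j / m - 1))) = (\<Sum>j\<in>S. s j * (1 - r) + r / m * (s j * d j))"
      by (rule sum.cong) (simp_all add: algebra_simps)
    also have "\<dots> = sum s S * (1 - r) + r / m * m"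
      by (simp add: sum.distrib sum_distrib_left sum_distrib_right m_def)
    finally show ?thesis using m assms by simp
  qed
  also have "\<dots> \<le> m powr r * (\<Sum>j\<in>S. s j * (d j / m) powr r)"
    using assms m by (intro mult_left_mono sum_mono powr_ge_tangent) auto
  also have "\<dots> = (\<Sum>j\<in>S. s j * d j powr r)"
    using m assms by (simp add: powr_divide sum_distrib_left)
  finally show ?thesis by (simp add: m_def)
qed

lemma lp_norm_doubly_stochastic:
  assumes "1 \<le> p"
    and s: "\<And>i j. i < n \<Longrightarrow> j < n \<Longrightarrow> 0 \<le> s i j"
    and rows: "\<And>i. i < n \<Longrightarrow> (\<Sum>j<n. s i j) = 1" and cols: "\<And>j. j < n \<Longrightarrow> (\<Sum>i<n. s i j) = (1::real)"
    and d: "\<And>j. j < n \<Longrightarrow> 0 \<le> d j"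
  shows "lp_norm p n (\<lambda>i. \<Sum>j<n. s i j * d j) \<le> lp_norm p n d"
  using \<open>1 \<le> p\<close>
proof (cases rule: ereal_ge_one_cases)
  case 1
  have "(\<Sum>j<n. s i j * d j) \<le> lp_norm \<infinity> n d" if "i < n" for i
  proof -
    have "(\<Sum>j<n. s i j * d j) \<le> (\<Sum>j<n. s i j * lp_norm \<infinity> n d)"
      using s that by (intro sum_mono mult_left_mono le_lp_norm_PInf) auto
    then show ?thesis using rows[OF that] by (simp flip: sum_distrib_right)
  qed
  then show ?thesis using 1 by (simp add: lp_norm_PInf_le_iff lp_norm_nonneg)
next
  case (2 r)
  have "(\<Sum>i<n. (\<Sum>j<n. s i j * d j) powr r) \<le> (\<Sum>i<n. \<Sum>j<n. s i j * d j powr r)"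
    using assms 2 by (intro sum_mono powr_jensen) auto
  also have "\<dots> = (\<Sum>j<n. (\<Sum>i<n. s i j) * d j powr r)"
    by (subst sum.swap) (simp add: sum_distrib_right)
  finally have "(\<Sum>i<n. (\<Sum>j<n. s i j * d j) powr r) \<le> (\<Sum>j<n. d j powr r)"
    using cols by simp
  then show ?thesis
    using 2 by (simp add: lp_norm_ereal powr_mono2 sum_nonneg)
qed

lemma lp_norm_quasiconvex:
  assumes "1 \<le> p" and t: "0 \<le> t" "t \<le> 1"
    and "\<And>i. i < n \<Longrightarrow> 0 \<le> c i" and "\<And>i. i < n \<Longrightarrow> 0 \<le> d i"
  shows "lp_norm p n (\<lambda>i. (1 - t) * c i + t * d i) \<le> max (lp_norm p n c) (lp_norm p n d)"
  using \<open>1 \<le> p\<close>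
proof (cases rule: ereal_ge_one_cases)
  case 1
  have "(1 - t) * c i + t * d i \<le> max (lp_norm \<infinity> n c) (lp_norm \<infinity> n d)" if "i < n" for i
    using le_lp_norm_PInf[OF that, of c] le_lp_norm_PInf[OF that, of d] t
    by (intro convex_bound_le) auto
  then show ?thesis using 1 lp_norm_nonneg[of \<infinity> n c] unfolding 1 lp_norm_PInf_le_iff by simp
next
  case (2 r)
  let ?C = "\<Sum>i<n. c i powr r" and ?D = "\<Sum>i<n. d i powr r"
  have "((1 - t) * c i + t * d i) powr r \<le> (1 - t) * c i powr r + t * d i powr r" if "i < n" for i
    using powr_jensen[of r "UNIV :: bool set" "\<lambda>x. if x then 1 - t else t" "\<lambda>x. if x then c i else d i"]
      2 t assms that by (simp add: UNIV_bool add.commute)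
  then have "(\<Sum>i<n. ((1 - t) * c i + t * d i) powr r) \<le> (\<Sum>i<n. (1 - t) * c i powr r + t * d i powr r)"
    by (intro sum_mono) auto
  also have "\<dots> = (1 - t) * ?C + t * ?D" by (simp add: sum.distrib sum_distrib_left)
  also have "\<dots> \<le> max ?C ?D" using t by (intro convex_bound_le) auto
  finally have *: "(\<Sum>i<n. ((1 - t) * c i + t * d i) powr r) \<le> max ?C ?D" .
  have "(\<Sum>i<n. ((1 - t) * c i + t * d i) powr r) powr (1/r) \<le> max ?C ?D powr (1/r)"
    using 2 * by (intro powr_mono2) (auto intro: sum_nonneg)
  also have "\<dots> \<le> max (?C powr (1/r)) (?D powr (1/r))" by (simp add: max_def)
  finally show ?thesis using 2 by (simp add: lp_norm_ereal)
qed

lemma lp_norm_le_one: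
  assumes "1 \<le> p" and d: "\<And>i. i < n \<Longrightarrow> 0 \<le> d i" and one: "(\<Sum>i<n. d i) = 1"
  shows "lp_norm p n d \<le> 1"
proof -
  have le: "d i \<le> 1" if "i < n" for i
    using member_le_sum[of i "{..<n}" d] that d one by auto
  show ?thesis using \<open>1 \<le> p\<close>
  proof (cases rule: ereal_ge_one_cases)
    case 1
    then show ?thesis using le by (simp add: lp_norm_PInf_le_iff)
  next
    case (2 r)
    have "d i powr r \<le> d i" if "i < n" for i
      using powr_mono'[of 1 r "d i"] 2 d[OF that] le[OF that] by simp
    then have "(\<Sum>i<n. d i powr r) \<le> 1"
      unfolding one[symmetric] by (intro sum_mono) auto
    then show ?thesis
      using 2 powr_mono2[of "1/r" "\<Sum>i<n. d i powr r" 1] by (simp add: lp_norm_ereal sum_nonneg)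
  qed
qed

lemma lp_norm_uniform_le:
  assumes "1 \<le> p" and "0 < n" and "\<And>i. i < n \<Longrightarrow> 0 \<le> d i" and "(\<Sum>i<n. d i) = 1"
  shows "lp_norm p n (\<lambda>_. 1 / real n) \<le> lp_norm p n d"
proof -
  have "lp_norm p n (\<lambda>i. \<Sum>j<n. 1 / real n * d j) \<le> lp_norm p n d"
    using assms by (intro lp_norm_doubly_stochastic) auto
  then show ?thesis using assms by (simp flip: sum_divide_distrib)
qed

lemma sum_lessThan_mult:
  fixes f :: "nat \<Rightarrow> 'a::comm_monoid_add"
  shows "(\<Sum>i<k * b. f i) = (\<Sum>i<k. \<Sum>\<beta><b. f (i * b + \<beta>))"
proof -
  have "(\<Sum>i<k. sum f {i * b..<i * b + b}) = (\<Sum>i<k * b. f i)" by (rule sum.nat_group)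
  moreover have "sum f {i * b..<i * b + b} = (\<Sum>\<beta><b. f (i * b + \<beta>))" for i
    using sum.shift_bounds_nat_ivl[of f 0 "i * b" b] by (simp add: lessThan_atLeast0 add.commute)
  ultimately show ?thesis by simp
qed

lemma lp_norm_tensor_const:
  assumes "1 \<le> p" and "0 < b" and "0 \<le> c" and d: "\<And>i. i < k \<Longrightarrow> 0 \<le> d i"
  shows "lp_norm p (k * b) (\<lambda>i. d (i div b) * c) = lp_norm p k d * lp_norm p b (\<lambda>_. c)"
  using \<open>1 \<le> p\<close>
proof (cases rule: ereal_ge_one_cases)
  case 1
  have "(\<lambda>i. i div b) ` {..<k * b} = {..<k}"
  proof (intro subset_antisym subsetI)
    fix i assume "i \<in> {..<k}"
    then show "i \<in> (\<lambda>i. i div b) ` {..<k * b}"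
      using \<open>0 < b\<close> by (intro image_eqI[of _ _ "i * b"]) auto
  qed (use \<open>0 < b\<close> in \<open>auto simp: less_mult_imp_div_less\<close>)
  then have "(\<lambda>i. c * d i) ` {..<k} = (\<lambda>i. c * d i) ` (\<lambda>i. i div b) ` {..<k * b}"
    by (rule arg_cong[OF sym])
  also have "\<dots> = (\<lambda>i. d (i div b) * c) ` {..<k * b}"
    by (simp only: image_image mult.commute)
  finally have "lp_norm \<infinity> (k * b) (\<lambda>i. d (i div b) * c) = lp_norm \<infinity> k (\<lambda>i. c * d i)"
    by (simp add: lp_norm_def)
  also have "\<dots> = c * lp_norm \<infinity> k d" using assms 1 by (intro lp_norm_cmult) auto
  finally have "lp_norm \<infinity> (k * b) (\<lambda>i. d (i div b) * c) = c * lp_norm \<infinity> k d" .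
  moreover have "lp_norm \<infinity> b (\<lambda>_. c) = c"
    using assms le_lp_norm_PInf[of 0 b "\<lambda>_. c"] by (intro antisym) (auto simp: lp_norm_PInf_le_iff)
  ultimately show ?thesis unfolding 1 by simp
next
  case (2 r)
  have "(\<Sum>i<k * b. (d (i div b) * c) powr r) = (\<Sum>i<k. \<Sum>\<beta><b. d i powr r * c powr r)"
    unfolding sum_lessThan_mult using assms by (intro sum.cong refl) (auto simp: powr_mult)
  also have "\<dots> = (\<Sum>i<k. d i powr r) * (\<Sum>\<beta><b. c powr r)"
    by (simp add: sum_distrib_left sum_distrib_right mult_ac)
  finally show ?thesis using 2 by (simp add: lp_norm_ereal powr_mult sum_nonneg)
qed

subsection \<open>Spectral theorem for Hermitian matrices\<close>

lemma conj_tr_carrier [simp]: "A \<in> carrier_mat n m \<Longrightarrow> conj_tr A \<in> carrier_mat m n"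
  by (auto simp: conj_tr_def mat_adjoint_def)

lemma conj_tr_dim [simp]: "dim_row (conj_tr A) = dim_col A" "dim_col (conj_tr A) = dim_row A"
  by (simp_all add: conj_tr_def mat_adjoint_def)

lemma conj_tr_index: "A \<in> carrier_mat n m \<Longrightarrow> i < m \<Longrightarrow> j < n \<Longrightarrow> conj_tr A $$ (i, j) = cnj (A $$ (j, i))"
  by (simp add: conj_tr_def mat_adjoint_def mat_of_rows_index)

lemma mult_mat_index_sum:
  assumes "A \<in> carrier_mat n m" "B \<in> carrier_mat m l" "i < n" "j < l"
  shows "(A * B) $$ (i, j) = (\<Sum>k<m. A $$ (i, k) * B $$ (k, j))"
  using assms by (simp add: scalar_prod_def lessThan_atLeast0)

lemma conj_tr_mult:
  assumes "A \<in> carrier_mat n m" "B \<in> carrier_mat m l"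
  shows "conj_tr (A * B) = conj_tr B * conj_tr A"
proof (rule eq_matI)
  fix i j assume "i < dim_row (conj_tr B * conj_tr A)" "j < dim_col (conj_tr B * conj_tr A)"
  then have "i < l" "j < n" using assms conj_tr_carrier[OF assms(1)] conj_tr_carrier[OF assms(2)] by auto
  then show "conj_tr (A * B) $$ (i, j) = (conj_tr B * conj_tr A) $$ (i, j)"
    using assms by (simp add: conj_tr_index[OF mult_carrier_mat[OF assms]] mult_mat_index_sum[of _ l m _ n]
      mult_mat_index_sum[of _ n m _ l] conj_tr_index[of _ n m] conj_tr_index[of _ m l] mult.commute
      del: index_mult_mat)
qed simp_all

lemma unitary_mat_cols:
  assumes "unitary_mat n W" "i < n" "j < n"
  shows "(\<Sum>k<n. cnj (W $$ (k, i)) * W $$ (k, j)) = (if i = j then 1 else 0)"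
proof -
  have W: "W \<in> carrier_mat n n" and "conj_tr W * W = 1\<^sub>m n" using assms by (auto simp: unitary_mat_def)
  then have "(conj_tr W * W) $$ (i, j) = (if i = j then 1 else 0)" using assms by simp
  then show ?thesis
    using assms W by (simp add: mult_mat_index_sum[of _ n n _ n] conj_tr_index[of _ n n] del: index_mult_mat)
qed

lemma unitary_mat_rows:
  assumes "unitary_mat n W" "i < n" "j < n"
  shows "(\<Sum>k<n. W $$ (i, k) * cnj (W $$ (j, k))) = (if i = j then 1 else 0)"
proof -
  have W: "W \<in> carrier_mat n n" and "W * conj_tr W = 1\<^sub>m n" using assms by (auto simp: unitary_mat_def)
  then have "(W * conj_tr W) $$ (i, j) = (if i = j then 1 else 0)" using assms by simp
  then show ?thesis
    using assms W by (simp add: mult_mat_index_sum[of _ n n _ n] conj_tr_index[of _ n n] del: index_mult_mat)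
qed

lemma unitary_matI:
  assumes W: "W \<in> carrier_mat n n"
    and cols: "\<And>i j. i < n \<Longrightarrow> j < n \<Longrightarrow> (\<Sum>k<n. cnj (W $$ (k, i)) * W $$ (k, j)) = (if i = j then 1 else 0)"
  shows "unitary_mat n W"
proof -
  have "conj_tr W * W = 1\<^sub>m n"
    using W conj_tr_carrier[OF W] cols
    by (intro eq_matI) (auto simp: mult_mat_index_sum[of _ n n _ n] conj_tr_index[of _ n n] simp del: index_mult_mat(1))
  then show ?thesis
    using W mat_mult_left_right_inverse[OF conj_tr_carrier[OF W] W] by (simp add: unitary_mat_def)
qed

lemma unitary_mat_carrier: "unitary_mat n W \<Longrightarrow> W \<in> carrier_mat n n"
  by (simp add: unitary_mat_def)

lemma unitary_mat_adjoint:
  assumes "unitary_mat n W"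
  shows "unitary_mat n (conj_tr W)"
proof (rule unitary_matI)
  show "conj_tr W \<in> carrier_mat n n" using assms by (simp add: unitary_mat_def)
  show "(\<Sum>k<n. cnj (conj_tr W $$ (k, i)) * conj_tr W $$ (k, j)) = (if i = j then 1 else 0)"
    if "i < n" "j < n" for i j
    using unitary_mat_rows[OF assms that] that by (simp add: conj_tr_index[OF unitary_mat_carrier[OF assms]])
qed

lemma unitary_mat_mult:
  assumes "unitary_mat n W" "unitary_mat n Q"
  shows "unitary_mat n (W * Q)"
proof -
  note c = assms[THEN unitary_mat_carrier]
  note c' = c[THEN conj_tr_carrier]
  have "conj_tr (W * Q) * (W * Q) = conj_tr Q * (conj_tr W * W) * Q"
    using c c' by (simp add: conj_tr_mult[OF c] assoc_mult_mat[of _ n n _ n _ n] mult_carrier_mat[of _ n n _ n])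
  also have "\<dots> = 1\<^sub>m n" using assms c' c by (simp add: unitary_mat_def)
  finally have *: "conj_tr (W * Q) * (W * Q) = 1\<^sub>m n" .
  have "W * Q \<in> carrier_mat n n" using c by simp
  then show ?thesis
    using * mat_mult_left_right_inverse[OF conj_tr_carrier _ *] by (simp add: unitary_mat_def)
qed

definition hermitian_mat :: "nat \<Rightarrow> complex mat \<Rightarrow> bool" where
  "hermitian_mat n A \<longleftrightarrow> A \<in> carrier_mat n n \<and> (\<forall>i<n. \<forall>j<n. A $$ (i, j) = cnj (A $$ (j, i)))"

lemma hermitian_mat_carrier: "hermitian_mat n A \<Longrightarrow> A \<in> carrier_mat n n"
  by (simp add: hermitian_mat_def)

lemma hermitian_mat_cnj: "hermitian_mat n A \<Longrightarrow> i < n \<Longrightarrow> j < n \<Longrightarrow> cnj (A $$ (j, i)) = A $$ (i, j)"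
  unfolding hermitian_mat_def by metis

lemma hermitian_matI:
  "A \<in> carrier_mat n n \<Longrightarrow> (\<And>i j. i < n \<Longrightarrow> j < n \<Longrightarrow> cnj (A $$ (j, i)) = A $$ (i, j)) \<Longrightarrow> hermitian_mat n A"
  unfolding hermitian_mat_def by metis

definition diag_of :: "nat \<Rightarrow> (nat \<Rightarrow> real) \<Rightarrow> complex mat" where
  "diag_of n d = mat n n (\<lambda>(i, j). if i = j then complex_of_real (d i) else 0)"

definition diagonalizes :: "nat \<Rightarrow> complex mat \<Rightarrow> complex mat \<Rightarrow> (nat \<Rightarrow> real) \<Rightarrow> bool" where
  "diagonalizes n A W d \<longleftrightarrow> unitary_mat n W \<and> A = W * diag_of n d * conj_tr W"

lemma diag_of_carrier [simp]: "diag_of n d \<in> carrier_mat n n"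
  by (simp add: diag_of_def)

lemma conj_mat_diag_index:
  assumes "W \<in> carrier_mat n n" "i < n" "j < n"
  shows "(W * diag_of n d * conj_tr W) $$ (i, j) = (\<Sum>l<n. W $$ (i, l) * complex_of_real (d l) * cnj (W $$ (j, l)))"
proof -
  have "(W * diag_of n d) $$ (i, l) = W $$ (i, l) * complex_of_real (d l)" if "l < n" for l
    using assms that
    by (simp add: mult_mat_index_sum[of _ n n _ n] diag_of_def if_distrib cong: if_cong del: index_mult_mat)
  then show ?thesis
    using assms conj_tr_carrier[OF assms(1)]
    by (subst mult_mat_index_sum[of _ n n _ n]) (simp_all add: conj_tr_index[of _ n n] mult_carrier_mat[of _ n n _ n] del: index_mult_mat)
qed

lemma diagonalizes_index:
  "diagonalizes n A W d \<Longrightarrow> i < n \<Longrightarrow> j < n \<Longrightarrow>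
    A $$ (i, j) = (\<Sum>l<n. W $$ (i, l) * complex_of_real (d l) * cnj (W $$ (j, l)))"
  by (simp add: diagonalizes_def conj_mat_diag_index unitary_mat_carrier del: index_mult_mat)

lemma diagonalizes_carrier: "diagonalizes n A W d \<Longrightarrow> A \<in> carrier_mat n n"
  by (auto simp: diagonalizes_def unitary_mat_def intro!: mult_carrier_mat[of _ n n _ n])

lemma diagonalizesI:
  assumes "A \<in> carrier_mat n n" "unitary_mat n W"
    and "\<And>i j. i < n \<Longrightarrow> j < n \<Longrightarrow>
      A $$ (i, j) = (\<Sum>l<n. W $$ (i, l) * complex_of_real (d l) * cnj (W $$ (j, l)))"
  shows "diagonalizes n A W d"
  unfolding diagonalizes_def
proof (intro conjI eq_matI)
  note W = unitary_mat_carrier[OF assms(2)]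
  have c: "W * diag_of n d * conj_tr W \<in> carrier_mat n n"
    using mult_carrier_mat[OF mult_carrier_mat[OF W diag_of_carrier] conj_tr_carrier[OF W]] .
  show "A $$ (i, j) = (W * diag_of n d * conj_tr W) $$ (i, j)"
    if "i < dim_row (W * diag_of n d * conj_tr W)" "j < dim_col (W * diag_of n d * conj_tr W)" for i j
    using that c assms conj_mat_diag_index[OF W, of i j d] by (auto simp del: index_mult_mat(1))
  show "dim_row A = dim_row (W * diag_of n d * conj_tr W)" "dim_col A = dim_col (W * diag_of n d * conj_tr W)"
    using c assms(1) by (metis carrier_matD)+
qed (rule assms)

lemma unitary_mat_with_first_column:
  fixes v :: "complex vec"
  assumes v: "v \<in> carrier_vec n" "v \<noteq> 0\<^sub>v n" and n: "0 < n"
  obtains W c where "unitary_mat n W" "\<And>i. i < n \<Longrightarrow> W $$ (i, 0) = c * v $ i"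
proof -
  interpret cof_vec_space n "TYPE(complex)" .
  define B where "B = basis_completion v"
  from basis_completion[OF v, folded B_def]
  have dist: "distinct B" and indep: "\<not> lin_dep (set B)" and B: "set B \<subseteq> carrier_vec n"
    and hdb: "hd B = v" and len: "length B = n"
    by auto
  from hdb len n obtain vs where Bv: "B = v # vs" by (cases B) auto
  define ws where "ws = gram_schmidt n B"
  from gram_schmidt_result[OF B dist indep refl, folded ws_def]
  have ws: "set ws \<subseteq> carrier_vec n" "corthogonal ws" "length ws = n" by (auto simp: len)
  have "hd ws = v" using gram_schmidt_hd[OF v(1), of vs] unfolding ws_def Bv .
  then have ws0: "ws ! 0 = v" using ws(3) n by (cases ws) auto
  have car: "ws ! j \<in> carrier_vec n" if "j < n" for j using ws that by auto
  have ip: "ws ! j \<bullet>c ws ! i = (\<Sum>k<n. cnj (ws ! i $ k) * ws ! j $ k)" if "i < n" "j < n" for i j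
    using car[OF that(1)] car[OF that(2)] by (simp add: scalar_prod_def lessThan_atLeast0 mult.commute)
  define r where "r j = (\<Sum>k<n. (cmod (ws ! j $ k))\<^sup>2)" for j
  have ipj: "ws ! j \<bullet>c ws ! j = complex_of_real (r j)" if "j < n" for j
    unfolding ip[OF that that] r_def by (simp add: complex_norm_square mult.commute del: of_real_power)
  have orth: "ws ! j \<bullet>c ws ! i = 0 \<longleftrightarrow> j \<noteq> i" if "i < n" "j < n" for i j
    using corthogonalD[OF ws(2)] that ws(3) by simp
  have rpos: "0 < r j" if "j < n" for j
  proof -
    have "r j \<noteq> 0" using orth[OF that that] ipj[OF that] by auto
    moreover have "0 \<le> r j" by (simp add: r_def sum_nonneg)
    ultimately show ?thesis by simp
  qed
  define W where "W = mat n n (\<lambda>(i, j). complex_of_real (1 / sqrt (r j)) * (ws ! j $ i))"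
  have "unitary_mat n W"
  proof (rule unitary_matI)
    fix i j assume ij: "i < n" "j < n"
    have "(\<Sum>k<n. cnj (W $$ (k, i)) * W $$ (k, j))
        = complex_of_real (1 / sqrt (r i) * (1 / sqrt (r j))) * (ws ! j \<bullet>c ws ! i)"
      unfolding ip[OF ij] sum_distrib_left using ij by (intro sum.cong) (auto simp: W_def)
    also have "\<dots> = (if i = j then 1 else 0)"
    proof (cases "i = j")
      case True
      have "1 / sqrt (r j) * (1 / sqrt (r j)) * r j = 1" using rpos[OF ij(2)] by (simp add: field_simps)
      then have "complex_of_real (1 / sqrt (r j) * (1 / sqrt (r j))) * complex_of_real (r j) = 1"
        unfolding of_real_mult[symmetric] by (simp only: of_real_1)
      then show ?thesis using True ij by (simp add: ipj)
    qed (use orth ij in auto)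
    finally show "(\<Sum>k<n. cnj (W $$ (k, i)) * W $$ (k, j)) = (if i = j then 1 else 0)" .
  qed (simp add: W_def)
  moreover have "W $$ (i, 0) = complex_of_real (1 / sqrt (r 0)) * v $ i" if "i < n" for i
    using that n by (simp add: W_def ws0)
  ultimately show ?thesis by (rule that)
qed

lemma hermitian_mat_conj:
  assumes A: "hermitian_mat n A" and W: "W \<in> carrier_mat m n"
  shows "hermitian_mat m (W * A * conj_tr W)"
proof -
  note cA = hermitian_mat_carrier[OF A]
  have "conj_tr A = A"
    using cA by (intro eq_matI) (auto simp: conj_tr_index[of _ n n] hermitian_mat_cnj[OF A])
  moreover have "conj_tr (conj_tr W) = W"
    using W conj_tr_carrier[OF conj_tr_carrier[OF W]] conj_tr_carrier[OF W]
    by (intro eq_matI) (auto simp: conj_tr_index[of _ n m] conj_tr_index[of _ m n])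
  ultimately have "conj_tr (W * A * conj_tr W) = W * (A * conj_tr W)"
    using conj_tr_mult[OF mult_carrier_mat[OF W cA] conj_tr_carrier[OF W]] conj_tr_mult[OF W cA] by simp
  then have "conj_tr (W * A * conj_tr W) = W * A * conj_tr W"
    using assoc_mult_mat[OF W cA conj_tr_carrier[OF W]] by simp
  moreover have c: "W * A * conj_tr W \<in> carrier_mat m m"
    using mult_carrier_mat[OF mult_carrier_mat[OF W cA] conj_tr_carrier[OF W]] .
  ultimately show ?thesis
    using conj_tr_index[OF c] unfolding hermitian_mat_def by metis
qed

theorem hermitian_diagonalizable:
  "hermitian_mat n A \<Longrightarrow> \<exists>W d. diagonalizes n A W d"
proof (induction n arbitrary: A)
  case 0
  then have "diagonalizes 0 A (1\<^sub>m 0) (\<lambda>_. 0)"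
    by (intro diagonalizesI unitary_matI) (auto simp: hermitian_mat_def)
  then show ?case by blast
next
  case (Suc n)
  let ?N = "Suc n"
  have A: "A \<in> carrier_mat ?N ?N" using Suc.prems by (simp add: hermitian_mat_def)
  obtain e where "eigenvalue A e" using spectrum_non_empty[OF A] by (auto simp: spectrum_def)
  then obtain v where v: "v \<in> carrier_vec ?N" "v \<noteq> 0\<^sub>v ?N" and ev: "A *\<^sub>v v = e \<cdot>\<^sub>v v"
    using A by (auto simp: eigenvalue_def eigenvector_def)
  obtain W c where W: "unitary_mat ?N W" and W0: "\<And>i. i < ?N \<Longrightarrow> W $$ (i, 0) = c * v $ i"
    using unitary_mat_with_first_column[OF v] by blast
  note cW = unitary_mat_carrier[OF W]
  note cW' = conj_tr_carrier[OF cW]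
  define B where "B = conj_tr W * A * W"
  have WW: "conj_tr (conj_tr W) = W"
    using cW conj_tr_carrier[OF cW'] by (intro eq_matI) (auto simp: conj_tr_index[OF cW'] conj_tr_index[OF cW])
  have hB: "hermitian_mat ?N B"
    using hermitian_mat_conj[OF Suc.prems cW'] by (simp add: B_def WW)
  then have cB: "B \<in> carrier_mat ?N ?N" by (simp add: hermitian_mat_def)
  have AW0: "(A * W) $$ (i, 0) = e * W $$ (i, 0)" if "i < ?N" for i
  proof -
    have "(A * W) $$ (i, 0) = c * (A *\<^sub>v v) $ i"
      using that A cW v W0
      by (simp add: mult_mat_index_sum[of _ ?N ?N _ ?N] scalar_prod_def lessThan_atLeast0 sum_distrib_left mult_ac
          del: index_mult_mat sum.op_ivl_Suc sum.lessThan_Suc)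
    then show ?thesis using that v W0 by (simp add: ev)
  qed
  have B0: "B $$ (i, 0) = (if i = 0 then e else 0)" if "i < ?N" for i
  proof -
    have "B = conj_tr W * (A * W)" using cW cW' A by (simp add: B_def assoc_mult_mat[of _ ?N ?N _ ?N _ ?N] mult_carrier_mat[of _ ?N ?N _ ?N])
    then have "B $$ (i, 0) = (\<Sum>k<?N. cnj (W $$ (k, i)) * (A * W) $$ (k, 0))"
      using that cW cW' A by (simp add: mult_mat_index_sum[OF cW' mult_carrier_mat[OF A cW]] conj_tr_index[OF cW]
          del: index_mult_mat sum.lessThan_Suc)
    also have "\<dots> = e * (\<Sum>k<?N. cnj (W $$ (k, i)) * W $$ (k, 0))"
      using AW0 by (simp add: sum_distrib_left mult_ac del: index_mult_mat sum.lessThan_Suc)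
    finally show ?thesis using unitary_mat_cols[OF W that, of 0] by simp
  qed
  have B0': "B $$ (0, j) = (if j = 0 then complex_of_real (Re e) else 0)" if "j < ?N" for j
  proof -
    have "B $$ (0, j) = cnj (B $$ (j, 0))" "B $$ (0, 0) = cnj (B $$ (0, 0))"
      using hB that unfolding hermitian_mat_def by blast+
    then show ?thesis using B0[OF that] B0[of 0] by (auto simp: complex_eq_iff)
  qed
  define C where "C = mat n n (\<lambda>(i, j). B $$ (Suc i, Suc j))"
  have "hermitian_mat n C" by (rule hermitian_matI) (simp_all add: C_def hermitian_mat_cnj[OF hB])
  from Suc.IH[OF this] obtain P d where P: "diagonalizes n C P d" by blast
  then have uP: "unitary_mat n P" by (simp add: diagonalizes_def)
  define Q where "Q = mat ?N ?N (\<lambda>(i, j). case (i, j) of (0, 0) \<Rightarrow> 1 | (Suc i, Suc j) \<Rightarrow> P $$ (i, j) | _ \<Rightarrow> 0)"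
  have Q [simp]: "Q $$ (0, 0) = 1" "i < n \<Longrightarrow> Q $$ (0, Suc i) = 0" "i < n \<Longrightarrow> Q $$ (Suc i, 0) = 0"
    "i < n \<Longrightarrow> j < n \<Longrightarrow> Q $$ (Suc i, Suc j) = P $$ (i, j)" for i j
    by (auto simp: Q_def)
  have cQ: "Q \<in> carrier_mat ?N ?N" by (simp add: Q_def)
  have uQ: "unitary_mat ?N Q"
  proof (rule unitary_matI[OF cQ])
    fix i j assume "i < ?N" "j < ?N"
    then show "(\<Sum>k<?N. cnj (Q $$ (k, i)) * Q $$ (k, j)) = (if i = j then 1 else 0)"
      using unitary_mat_cols[OF uP, of "i - 1" "j - 1"]
      by (cases i; cases j) (simp_all add: sum.lessThan_Suc_shift del: sum.lessThan_Suc)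
  qed
  have "diagonalizes ?N B Q (case_nat (Re e) d)"
  proof (rule diagonalizesI[OF cB uQ])
    fix i j assume ij: "i < ?N" "j < ?N"
    have "B $$ (Suc i, Suc j) = (\<Sum>l<n. P $$ (i, l) * complex_of_real (d l) * cnj (P $$ (j, l)))"
      if "i < n" "j < n" for i j
      using diagonalizes_index[OF P that] that by (simp add: C_def)
    then show "B $$ (i, j) = (\<Sum>l<?N. Q $$ (i, l) * complex_of_real (case_nat (Re e) d l) * cnj (Q $$ (j, l)))"
      using ij B0[OF ij(1)] B0'[OF ij(2)]
      by (cases i; cases j) (simp_all add: sum.lessThan_Suc_shift del: sum.lessThan_Suc)
  qed
  then have B: "B = Q * diag_of ?N (case_nat (Re e) d) * conj_tr Q" by (simp add: diagonalizes_def)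
  have "A = (W * conj_tr W) * A * (W * conj_tr W)" using W A by (simp add: unitary_mat_def)
  also have "\<dots> = W * B * conj_tr W"
    using A cW cW' by (simp add: B_def assoc_mult_mat[of _ ?N ?N _ ?N _ ?N] mult_carrier_mat[of _ ?N ?N _ ?N])
  also have "\<dots> = (W * Q) * diag_of ?N (case_nat (Re e) d) * conj_tr (W * Q)"
    using cW cW' cQ conj_tr_carrier[OF cQ]
    by (simp add: B conj_tr_mult[OF cW cQ] assoc_mult_mat[of _ ?N ?N _ ?N _ ?N] mult_carrier_mat[of _ ?N ?N _ ?N])
  finally show ?case
    using unitary_mat_mult[OF W uQ] unfolding diagonalizes_def by blast
qed

subsection \<open>Schatten norms of positive semidefinite matrices\<close>

definition quad :: "nat \<Rightarrow> complex mat \<Rightarrow> (nat \<Rightarrow> complex) \<Rightarrow> complex" where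
  "quad n A v = (\<Sum>i<n. \<Sum>j<n. cnj (v i) * A $$ (i, j) * v j)"

definition psd_mat :: "nat \<Rightarrow> complex mat \<Rightarrow> bool" where
  "psd_mat n A \<longleftrightarrow> hermitian_mat n A \<and> (\<forall>v. 0 \<le> Re (quad n A v))"

lemma psd_mat_carrier: "psd_mat n A \<Longrightarrow> A \<in> carrier_mat n n"
  by (simp add: psd_mat_def hermitian_mat_def)

lemma diagonalizes_quad:
  assumes "diagonalizes n A W d"
  shows "quad n A v = complex_of_real (\<Sum>l<n. d l * (cmod (\<Sum>j<n. cnj (W $$ (j, l)) * v j))\<^sup>2)"
proof -
  let ?f = "\<lambda>l. \<Sum>j<n. cnj (W $$ (j, l)) * v j"
  have "quad n A v = (\<Sum>i<n. \<Sum>j<n. \<Sum>l<n. complex_of_real (d l) * (W $$ (i, l) * cnj (v i)) * (cnj (W $$ (j, l)) * v j))"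
    unfolding quad_def
    by (intro sum.cong refl)
      (simp add: diagonalizes_index[OF assms] sum_distrib_left sum_distrib_right mult_ac)
  also have "\<dots> = (\<Sum>i<n. \<Sum>l<n. \<Sum>j<n. complex_of_real (d l) * (W $$ (i, l) * cnj (v i)) * (cnj (W $$ (j, l)) * v j))"
    by (intro sum.cong refl sum.swap)
  also have "\<dots> = (\<Sum>l<n. \<Sum>i<n. \<Sum>j<n. complex_of_real (d l) * (W $$ (i, l) * cnj (v i)) * (cnj (W $$ (j, l)) * v j))"
    by (rule sum.swap)
  also have "\<dots> = (\<Sum>l<n. complex_of_real (d l) * (?f l * cnj (?f l)))"
    by (simp add: sum_distrib_left sum_distrib_right mult_ac)
  finally show ?thesis by (simp add: complex_norm_square del: of_real_power)
qed

lemma diagonalizes_quad_column: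
  assumes "diagonalizes n A W d" "l < n"
  shows "quad n A (\<lambda>j. W $$ (j, l)) = complex_of_real (d l)"
proof -
  have "unitary_mat n W" using assms by (simp add: diagonalizes_def)
  then have "(\<Sum>m<n. d m * (cmod (\<Sum>j<n. cnj (W $$ (j, m)) * W $$ (j, l)))\<^sup>2) = (\<Sum>m<n. d m * (if m = l then 1 else 0))"
    using assms(2) by (intro sum.cong) (auto simp: unitary_mat_cols)
  then show ?thesis using assms by (simp add: diagonalizes_quad if_distrib cong: if_cong)
qed

lemma diagonalizes_trace:
  assumes "diagonalizes n A W d"
  shows "(\<Sum>i<n. A $$ (i, i)) = complex_of_real (\<Sum>l<n. d l)"
proof -
  have W: "unitary_mat n W" using assms by (simp add: diagonalizes_def)
  have "(\<Sum>i<n. A $$ (i, i)) = (\<Sum>l<n. \<Sum>i<n. W $$ (i, l) * complex_of_real (d l) * cnj (W $$ (i, l)))"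
    using assms by (subst sum.swap) (simp add: diagonalizes_index)
  also have "\<dots> = (\<Sum>l<n. complex_of_real (d l) * (\<Sum>i<n. cnj (W $$ (i, l)) * W $$ (i, l)))"
    by (simp add: sum_distrib_left mult_ac)
  finally show ?thesis using unitary_mat_cols[OF W] by simp
qed

lemma psd_mat_diagonalizable:
  assumes "psd_mat n A"
  obtains W d where "diagonalizes n A W d" "\<And>l. l < n \<Longrightarrow> 0 \<le> d l"
proof -
  have "hermitian_mat n A" using assms by (simp add: psd_mat_def)
  from hermitian_diagonalizable[OF this] obtain W d where W: "diagonalizes n A W d" by blast
  moreover have "0 \<le> d l" if "l < n" for l
    using assms diagonalizes_quad_column[OF W that] unfolding psd_mat_def by (metis Re_complex_of_real)
  ultimately show ?thesis by (rule that)
qed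

lemma eigvals_list_unique:
  assumes "char_poly A = (\<Prod>a\<leftarrow>as. [:- a, 1:])"
  shows "mset (eigvals_list A) = mset as"
proof -
  have roots: "proots (\<Prod>a\<leftarrow>bs. [:- a, 1:]) = mset bs" for bs :: "complex list"
  proof (induction bs)
    case (Cons b bs)
    have "(\<Prod>a\<leftarrow>bs. [:- a, 1:]) \<noteq> 0" by (auto simp: prod_list_zero_iff)
    then have "proots ([:- b, 1:] * (\<Prod>a\<leftarrow>bs. [:- a, 1:])) = proots [:- b, 1:] + proots (\<Prod>a\<leftarrow>bs. [:- a, 1:])"
      by (intro proots_mult) auto
    then show ?case using Cons.IH by (simp del: mult_pCons_left)
  qed simp
  have "char_poly A = (\<Prod>a\<leftarrow>eigvals_list A. [:- a, 1:])"
    unfolding eigvals_list_def using assms by (rule someI)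
  then show ?thesis using assms roots by metis
qed

lemma mset_sing_vals:
  assumes A: "diagonalizes n A W d" and d: "\<And>l. l < n \<Longrightarrow> 0 \<le> d l"
  shows "mset (sing_vals A) = mset (map d [0..<n])"
proof -
  have W: "unitary_mat n W" and A_eq: "A = W * diag_of n d * conj_tr W" using A by (auto simp: diagonalizes_def)
  note cW = unitary_mat_carrier[OF W]
  note cW' = conj_tr_carrier[OF cW]
  note cA = diagonalizes_carrier[OF A]
  let ?D = "diag_of n d" and ?E = "diag_of n (\<lambda>i. (d i)\<^sup>2)"
  note assoc = assoc_mult_mat[of _ n n _ n _ n] mult_carrier_mat[of _ n n _ n]
  have hA: "conj_tr A = A"
  proof (rule eq_matI)
    fix i j assume "i < dim_row A" "j < dim_col A"
    then have ij: "i < n" "j < n" using cA by auto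
    then show "conj_tr A $$ (i, j) = A $$ (i, j)"
      by (simp add: conj_tr_index[OF cA] diagonalizes_index[OF A] mult_ac)
  qed (use cA in auto)
  have DD: "?D * ?D = ?E"
    by (rule eq_matI) (auto simp: diag_of_def scalar_prod_def power2_eq_square if_distrib cong: if_cong)
  have "conj_tr A * A = W * (?D * (conj_tr W * W) * ?D) * conj_tr W"
    unfolding hA using cW cW' by (simp add: A_eq assoc)
  also have "conj_tr W * W = 1\<^sub>m n" using W by (simp add: unitary_mat_def)
  finally have AA: "conj_tr A * A = W * ?E * conj_tr W" by (simp add: DD right_mult_one_mat[OF diag_of_carrier])
  have "similar_mat_wit (conj_tr A * A) ?E W (conj_tr W)"
    using W AA cW cW' conj_tr_carrier[OF cA] cA
    by (intro similar_mat_witI[of _ _ n]) (auto simp: unitary_mat_def intro: mult_carrier_mat)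
  then have "char_poly (conj_tr A * A) = char_poly ?E"
    by (intro char_poly_similar) (auto simp: similar_mat_def)
  also have "\<dots> = (\<Prod>a\<leftarrow>diag_mat ?E. [:- a, 1:])"
    by (rule char_poly_upper_triangular[of _ n]) (auto simp: diag_of_def)
  also have "diag_mat ?E = map (\<lambda>i. complex_of_real ((d i)\<^sup>2)) [0..<n]"
    by (auto simp: diag_mat_def diag_of_def)
  finally have "mset (eigvals_list (conj_tr A * A)) = mset (map (\<lambda>i. complex_of_real ((d i)\<^sup>2)) [0..<n])"
    by (rule eigvals_list_unique)
  then have "mset (sing_vals A) = image_mset (\<lambda>z. sqrt (Re z)) (mset (map (\<lambda>i. complex_of_real ((d i)\<^sup>2)) [0..<n]))"
    by (simp add: sing_vals_def)
  also have "\<dots> = mset (map (\<lambda>i. sqrt ((d i)\<^sup>2)) [0..<n])"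
    by (simp add: multiset.map_comp comp_def del: of_real_power)
  also have "map (\<lambda>i. sqrt ((d i)\<^sup>2)) [0..<n] = map d [0..<n]"
    using d by (intro map_cong) auto
  finally show ?thesis .
qed

lemma schatten_diagonalizes:
  assumes "diagonalizes n A W d" and "\<And>l. l < n \<Longrightarrow> 0 \<le> d l"
  shows "schatten p A = lp_norm p n d"
proof -
  note m = mset_sing_vals[OF assms]
  have "set (sing_vals A) = d ` {..<n}"
    using mset_eq_setD[OF m] by (auto simp: lessThan_atLeast0)
  moreover have "(\<Sum>s\<leftarrow>sing_vals A. f s) = (\<Sum>i<n. f (d i))" for f :: "real \<Rightarrow> real"
  proof -
    have "mset (map f (sing_vals A)) = mset (map f (map d [0..<n]))"
      by (simp only: mset_map m)
    from arg_cong[OF this, of sum_mset] have "(\<Sum>s\<leftarrow>sing_vals A. f s) = (\<Sum>s\<leftarrow>map d [0..<n]. f s)"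
      by (simp only: sum_mset_sum_list)
    then show ?thesis by (simp add: interv_sum_list_conv_sum_set_nat lessThan_atLeast0 comp_def)
  qed
  ultimately show ?thesis by (simp add: schatten_def lp_norm_def)
qed

text \<open>Peierls' inequality: the squared overlaps of two orthonormal bases are doubly stochastic.\<close>

lemma lp_norm_quad_le:
  assumes "1 \<le> p" and A: "psd_mat n A" and Q: "unitary_mat n Q"
  shows "lp_norm p n (\<lambda>l. Re (quad n A (\<lambda>j. Q $$ (j, l)))) \<le> schatten p A"
proof -
  obtain W d where W: "diagonalizes n A W d" and d: "\<And>l. l < n \<Longrightarrow> 0 \<le> d l"
    using psd_mat_diagonalizable[OF A] by blast
  have uW: "unitary_mat n W" using W by (simp add: diagonalizes_def)
  note cW = unitary_mat_carrier[OF uW]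
  note cQ = unitary_mat_carrier[OF Q]
  define S where "S = conj_tr W * Q"
  have uS: "unitary_mat n S"
    unfolding S_def by (rule unitary_mat_mult[OF unitary_mat_adjoint[OF uW] Q])
  have S: "S $$ (m, l) = (\<Sum>j<n. cnj (W $$ (j, m)) * Q $$ (j, l))" if "m < n" "l < n" for m l
    using that cW by (simp add: S_def mult_mat_index_sum[OF conj_tr_carrier[OF cW] cQ] conj_tr_index[OF cW] del: index_mult_mat)
  have sq: "complex_of_real ((cmod z)\<^sup>2) = cnj z * z" "complex_of_real ((cmod z)\<^sup>2) = z * cnj z" for z
    by (simp_all add: complex_norm_square mult.commute del: of_real_power)
  have "complex_of_real (\<Sum>m<n. (cmod (S $$ (m, l)))\<^sup>2) = 1" if "l < n" for l
    using unitary_mat_cols[OF uS that that] by (simp add: sq(1) del: of_real_power)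
  then have c1: "(\<Sum>m<n. (cmod (S $$ (m, l)))\<^sup>2) = 1" if "l < n" for l
    using that of_real_eq_1_iff by blast
  have "complex_of_real (\<Sum>l<n. (cmod (S $$ (m, l)))\<^sup>2) = 1" if "m < n" for m
    using unitary_mat_rows[OF uS that that] by (simp add: sq(2) del: of_real_power)
  then have c2: "(\<Sum>l<n. (cmod (S $$ (m, l)))\<^sup>2) = 1" if "m < n" for m
    using that of_real_eq_1_iff by blast
  have "Re (quad n A (\<lambda>j. Q $$ (j, l))) = (\<Sum>m<n. (cmod (S $$ (m, l)))\<^sup>2 * d m)" if "l < n" for l
    unfolding diagonalizes_quad[OF W] using S[OF _ that] by (simp add: mult.commute)
  then have "lp_norm p n (\<lambda>l. Re (quad n A (\<lambda>j. Q $$ (j, l)))) \<le> lp_norm p n (\<lambda>l. \<Sum>m<n. (cmod (S $$ (m, l)))\<^sup>2 * d m)"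
    using d by (intro lp_norm_mono[OF \<open>1 \<le> p\<close>]) (auto intro!: sum_nonneg)
  also have "\<dots> \<le> lp_norm p n d"
    using d c1 c2 by (intro lp_norm_doubly_stochastic[OF \<open>1 \<le> p\<close>]) auto
  finally show ?thesis by (simp add: schatten_diagonalizes[OF W d])
qed

lemma quad_lincomb:
  assumes "\<And>i j. i < n \<Longrightarrow> j < n \<Longrightarrow> C $$ (i, j) = complex_of_real s * A $$ (i, j) + complex_of_real t * B $$ (i, j)"
  shows "quad n C v = complex_of_real s * quad n A v + complex_of_real t * quad n B v"
proof -
  have "quad n C v = (\<Sum>i<n. \<Sum>j<n. complex_of_real s * (cnj (v i) * A $$ (i, j) * v j)
      + complex_of_real t * (cnj (v i) * B $$ (i, j) * v j))"
    unfolding quad_def using assms by (intro sum.cong refl) (simp add: algebra_simps)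
  then show ?thesis by (simp add: quad_def sum.distrib sum_distrib_left)
qed

lemma psd_mat_lincomb:
  assumes "psd_mat n A" "psd_mat n B" "0 \<le> s" "0 \<le> t" "C \<in> carrier_mat n n"
    and C: "\<And>i j. i < n \<Longrightarrow> j < n \<Longrightarrow> C $$ (i, j) = complex_of_real s * A $$ (i, j) + complex_of_real t * B $$ (i, j)"
  shows "psd_mat n C"
  unfolding psd_mat_def
proof (intro conjI hermitian_matI allI)
  show "cnj (C $$ (j, i)) = C $$ (i, j)" if "i < n" "j < n" for i j
    using that assms by (simp add: C psd_mat_def hermitian_mat_cnj[of n])
  show "0 \<le> Re (quad n C v)" for v
    using assms by (simp add: quad_lincomb[OF C] psd_mat_def)
qed fact

lemma schatten_quasiconvex:
  assumes "1 \<le> p" and A: "psd_mat n A" and B: "psd_mat n B" and t: "0 \<le> t" "t \<le> 1" and "C \<in> carrier_mat n n"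
    and C: "\<And>i j. i < n \<Longrightarrow> j < n \<Longrightarrow> C $$ (i, j) = complex_of_real (1 - t) * A $$ (i, j) + complex_of_real t * B $$ (i, j)"
  shows "schatten p C \<le> max (schatten p A) (schatten p B)"
proof -
  have "psd_mat n C" using assms by (intro psd_mat_lincomb[OF A B _ _ _ C]) auto
  then obtain Q c where Q: "diagonalizes n C Q c" and c: "\<And>l. l < n \<Longrightarrow> 0 \<le> c l"
    using psd_mat_diagonalizable by blast
  have uQ: "unitary_mat n Q" using Q by (simp add: diagonalizes_def)
  let ?a = "\<lambda>l. Re (quad n A (\<lambda>j. Q $$ (j, l)))" and ?b = "\<lambda>l. Re (quad n B (\<lambda>j. Q $$ (j, l)))"
  have "c l = (1 - t) * ?a l + t * ?b l" if "l < n" for l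
  proof -
    have "complex_of_real (c l) = complex_of_real (1 - t) * quad n A (\<lambda>j. Q $$ (j, l)) + complex_of_real t * quad n B (\<lambda>j. Q $$ (j, l))"
      unfolding diagonalizes_quad_column[OF Q that, symmetric] by (rule quad_lincomb) (rule C)
    from arg_cong[OF this, of Re] show ?thesis by simp
  qed
  then have "lp_norm p n c \<le> lp_norm p n (\<lambda>l. (1 - t) * ?a l + t * ?b l)"
    using c by (intro lp_norm_mono[OF \<open>1 \<le> p\<close>]) auto
  also have "\<dots> \<le> max (lp_norm p n ?a) (lp_norm p n ?b)"
    using A B t by (intro lp_norm_quasiconvex \<open>1 \<le> p\<close>) (auto simp: psd_mat_def)
  also have "\<dots> \<le> max (schatten p A) (schatten p B)"
    using lp_norm_quad_le[OF \<open>1 \<le> p\<close> A uQ] lp_norm_quad_le[OF \<open>1 \<le> p\<close> B uQ] by linarith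
  finally show ?thesis by (simp add: schatten_diagonalizes[OF Q c])
qed

lemma schatten_le_of_quad_le:
  assumes "1 \<le> p" and A: "psd_mat n A"
    and le: "\<And>v. (\<Sum>j<n. (cmod (v j))\<^sup>2) = 1 \<Longrightarrow> Re (quad n A v) \<le> c"
  shows "schatten p A \<le> lp_norm p n (\<lambda>_. c)"
proof -
  obtain W d where W: "diagonalizes n A W d" and d: "\<And>l. l < n \<Longrightarrow> 0 \<le> d l"
    using psd_mat_diagonalizable[OF A] by blast
  have uW: "unitary_mat n W" using W by (simp add: diagonalizes_def)
  have "d l \<le> c" if "l < n" for l
  proof -
    have "complex_of_real (\<Sum>j<n. (cmod (W $$ (j, l)))\<^sup>2) = 1"
      using unitary_mat_cols[OF uW that that] by (simp add: complex_norm_square mult.commute del: of_real_power)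
    then show ?thesis
      using le[of "\<lambda>j. W $$ (j, l)"] diagonalizes_quad_column[OF W that] of_real_eq_1_iff by fastforce
  qed
  then have "lp_norm p n d \<le> lp_norm p n (\<lambda>_. c)" using d by (intro lp_norm_mono[OF \<open>1 \<le> p\<close>])
  then show ?thesis using schatten_diagonalizes[OF W d] by simp
qed

lemma schatten_bounds_trace_one:
  assumes "1 \<le> p" "psd_mat n A" "(\<Sum>i<n. A $$ (i, i)) = 1" "0 < n"
  shows "schatten p A \<le> 1" "lp_norm p n (\<lambda>_. 1 / real n) \<le> schatten p A"
proof -
  obtain W d where W: "diagonalizes n A W d" and d: "\<And>l. l < n \<Longrightarrow> 0 \<le> d l"
    using psd_mat_diagonalizable[OF assms(2)] by blast
  have "(\<Sum>l<n. d l) = 1" using diagonalizes_trace[OF W] assms(3) of_real_eq_1_iff by metis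
  then have "lp_norm p n d \<le> 1" "lp_norm p n (\<lambda>_. 1 / real n) \<le> lp_norm p n d"
    using d assms by (auto intro!: lp_norm_le_one lp_norm_uniform_le)
  then show "schatten p A \<le> 1" "lp_norm p n (\<lambda>_. 1 / real n) \<le> schatten p A"
    using schatten_diagonalizes[OF W d] by simp_all
qed

lemma psd_mat_trace_zero:
  assumes "psd_mat n A" "(\<Sum>i<n. A $$ (i, i)) = 0" "i < n" "j < n"
  shows "A $$ (i, j) = 0"
proof -
  obtain W d where W: "diagonalizes n A W d" and d: "\<And>l. l < n \<Longrightarrow> 0 \<le> d l"
    using psd_mat_diagonalizable[OF assms(1)] by blast
  have "(\<Sum>l<n. d l) = 0" using diagonalizes_trace[OF W] assms(2) of_real_eq_0_iff by metis
  then have "\<forall>l\<in>{..<n}. d l = 0" using d by (subst (asm) sum_nonneg_eq_0_iff) auto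
  then show ?thesis using diagonalizes_index[OF W assms(3,4)] by simp
qed

subsection \<open>Unitary conjugation, partial trace and tensoring with the identity\<close>

lemma sum_swap4:
  "(\<Sum>i\<in>A. \<Sum>j\<in>B. \<Sum>k\<in>C. \<Sum>l\<in>D. f i j k l) = (\<Sum>k\<in>C. \<Sum>l\<in>D. \<Sum>i\<in>A. \<Sum>j\<in>B. f i j k l)"
proof -
  have "(\<Sum>i\<in>A. \<Sum>j\<in>B. \<Sum>k\<in>C. \<Sum>l\<in>D. f i j k l) = (\<Sum>i\<in>A. \<Sum>k\<in>C. \<Sum>j\<in>B. \<Sum>l\<in>D. f i j k l)"
    by (intro sum.cong refl sum.swap)
  also have "\<dots> = (\<Sum>k\<in>C. \<Sum>i\<in>A. \<Sum>j\<in>B. \<Sum>l\<in>D. f i j k l)"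
    by (rule sum.swap)
  also have "\<dots> = (\<Sum>k\<in>C. \<Sum>i\<in>A. \<Sum>l\<in>D. \<Sum>j\<in>B. f i j k l)"
    by (intro sum.cong refl sum.swap)
  also have "\<dots> = (\<Sum>k\<in>C. \<Sum>l\<in>D. \<Sum>i\<in>A. \<Sum>j\<in>B. f i j k l)"
    by (intro sum.cong refl sum.swap)
  finally show ?thesis .
qed

lemma conj_mat_index:
  assumes "U \<in> carrier_mat n n" "A \<in> carrier_mat n n" "i < n" "j < n"
  shows "(U * A * conj_tr U) $$ (i, j) = (\<Sum>k<n. \<Sum>l<n. U $$ (i, k) * A $$ (k, l) * cnj (U $$ (j, l)))"
proof -
  have "(U * A * conj_tr U) $$ (i, j) = (\<Sum>l<n. (U * A) $$ (i, l) * cnj (U $$ (j, l)))"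
    using assms by (simp add: mult_mat_index_sum[OF mult_carrier_mat[OF assms(1,2)] conj_tr_carrier[OF assms(1)]]
        conj_tr_index[OF assms(1)] del: index_mult_mat)
  also have "\<dots> = (\<Sum>l<n. \<Sum>k<n. U $$ (i, k) * A $$ (k, l) * cnj (U $$ (j, l)))"
    using assms by (simp add: mult_mat_index_sum[OF assms(1,2)] sum_distrib_right del: index_mult_mat)
  also have "\<dots> = (\<Sum>k<n. \<Sum>l<n. U $$ (i, k) * A $$ (k, l) * cnj (U $$ (j, l)))"
    by (rule sum.swap)
  finally show ?thesis .
qed

lemma quad_conj:
  assumes "U \<in> carrier_mat n n" "A \<in> carrier_mat n n"
  shows "quad n (U * A * conj_tr U) v = quad n A (\<lambda>j. \<Sum>i<n. cnj (U $$ (i, j)) * v i)"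
proof -
  have "quad n (U * A * conj_tr U) v
      = (\<Sum>i<n. \<Sum>j<n. \<Sum>k<n. \<Sum>l<n. (U $$ (i, k) * cnj (v i)) * A $$ (k, l) * (cnj (U $$ (j, l)) * v j))"
    unfolding quad_def
    by (intro sum.cong refl) (simp add: conj_mat_index[OF assms] sum_distrib_left sum_distrib_right mult_ac del: index_mult_mat)
  also have "\<dots> = (\<Sum>k<n. \<Sum>l<n. \<Sum>i<n. \<Sum>j<n. (U $$ (i, k) * cnj (v i)) * A $$ (k, l) * (cnj (U $$ (j, l)) * v j))"
    by (rule sum_swap4)
  also have "\<dots> = quad n A (\<lambda>j. \<Sum>i<n. cnj (U $$ (i, j)) * v i)"
    unfolding quad_def by (intro sum.cong refl) (simp add: sum_distrib_left sum_distrib_right mult_ac)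
  finally show ?thesis .
qed

lemma psd_mat_conj:
  assumes "U \<in> carrier_mat n n" "psd_mat n A"
  shows "psd_mat n (U * A * conj_tr U)"
  using assms hermitian_mat_conj[of n A U n] by (simp add: psd_mat_def quad_conj hermitian_mat_carrier)

lemma trace_conj:
  assumes U: "unitary_mat n U" and A: "A \<in> carrier_mat n n"
  shows "(\<Sum>i<n. (U * A * conj_tr U) $$ (i, i)) = (\<Sum>i<n. A $$ (i, i))"
proof -
  note cU = unitary_mat_carrier[OF U]
  have "(\<Sum>i<n. (U * A * conj_tr U) $$ (i, i)) = (\<Sum>i<n. \<Sum>k<n. \<Sum>l<n. U $$ (i, k) * A $$ (k, l) * cnj (U $$ (i, l)))"
    by (simp add: conj_mat_index[OF cU A] del: index_mult_mat)
  also have "\<dots> = (\<Sum>k<n. \<Sum>i<n. \<Sum>l<n. U $$ (i, k) * A $$ (k, l) * cnj (U $$ (i, l)))"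
    by (rule sum.swap)
  also have "\<dots> = (\<Sum>k<n. \<Sum>l<n. \<Sum>i<n. U $$ (i, k) * A $$ (k, l) * cnj (U $$ (i, l)))"
    by (intro sum.cong refl sum.swap)
  also have "\<dots> = (\<Sum>k<n. \<Sum>l<n. A $$ (k, l) * (\<Sum>i<n. cnj (U $$ (i, l)) * U $$ (i, k)))"
    by (simp add: sum_distrib_left mult_ac)
  also have "\<dots> = (\<Sum>k<n. A $$ (k, k))"
    by (simp add: unitary_mat_cols[OF U] if_distrib cong: if_cong)
  finally show ?thesis .
qed

lemma mult_add_less: "i < k \<Longrightarrow> \<beta> < b \<Longrightarrow> i * b + \<beta> < k * (b::nat)"
proof -
  assume "i < k" "\<beta> < b"
  then have "i * b + \<beta> < Suc i * b" by simp
  also have "\<dots> \<le> k * b" using \<open>i < k\<close> by (intro mult_le_mono1) simp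
  finally show ?thesis .
qed

lemma quad_ptrace_B:
  "quad k (ptrace_B k b Y) v = (\<Sum>\<beta><b. quad (k * b) Y (\<lambda>i. if i mod b = \<beta> then v (i div b) else 0))"
proof -
  have "quad (k * b) Y (\<lambda>i. if i mod b = \<beta> then v (i div b) else 0)
      = (\<Sum>i<k. \<Sum>j<k. cnj (v i) * Y $$ (i * b + \<beta>, j * b + \<beta>) * v j)" if "\<beta> < b" for \<beta>
  proof -
    have "quad (k * b) Y (\<lambda>i. if i mod b = \<beta> then v (i div b) else 0)
      = (\<Sum>i<k. \<Sum>\<gamma><b. \<Sum>j<k. \<Sum>\<delta><b. if \<gamma> = \<beta> then (if \<delta> = \<beta> then cnj (v i) * Y $$ (i * b + \<gamma>, j * b + \<delta>) * v j else 0) else 0)"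
      unfolding quad_def sum_lessThan_mult by (intro sum.cong refl) auto
    also have "\<dots> = (\<Sum>i<k. \<Sum>\<gamma><b. if \<gamma> = \<beta> then (\<Sum>j<k. \<Sum>\<delta><b. if \<delta> = \<beta> then cnj (v i) * Y $$ (i * b + \<gamma>, j * b + \<delta>) * v j else 0) else 0)"
      by (intro sum.cong refl) auto
    finally show ?thesis using that by simp
  qed
  then have "(\<Sum>\<beta><b. quad (k * b) Y (\<lambda>i. if i mod b = \<beta> then v (i div b) else 0))
      = (\<Sum>\<beta><b. \<Sum>i<k. \<Sum>j<k. cnj (v i) * Y $$ (i * b + \<beta>, j * b + \<beta>) * v j)"
    by (intro sum.cong) auto
  also have "\<dots> = (\<Sum>i<k. \<Sum>\<beta><b. \<Sum>j<k. cnj (v i) * Y $$ (i * b + \<beta>, j * b + \<beta>) * v j)"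
    by (rule sum.swap)
  also have "\<dots> = (\<Sum>i<k. \<Sum>j<k. \<Sum>\<beta><b. cnj (v i) * Y $$ (i * b + \<beta>, j * b + \<beta>) * v j)"
    by (intro sum.cong refl sum.swap)
  also have "\<dots> = quad k (ptrace_B k b Y) v"
    unfolding quad_def by (intro sum.cong refl) (simp add: ptrace_B_def sum_distrib_left sum_distrib_right)
  finally show ?thesis by simp
qed

lemma psd_mat_ptrace_B:
  assumes "psd_mat (k * b) Y"
  shows "psd_mat k (ptrace_B k b Y)"
  unfolding psd_mat_def
proof (intro conjI hermitian_matI allI)
  have h: "hermitian_mat (k * b) Y" using assms by (simp add: psd_mat_def)
  show "cnj (ptrace_B k b Y $$ (j, i)) = ptrace_B k b Y $$ (i, j)" if "i < k" "j < k" for i j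
    using that by (simp add: ptrace_B_def hermitian_mat_cnj[OF h] mult_add_less)
  show "0 \<le> Re (quad k (ptrace_B k b Y) v)" for v
    using assms by (simp add: quad_ptrace_B psd_mat_def sum_nonneg)
qed (simp add: ptrace_B_def)

lemma trace_ptrace_B: "(\<Sum>i<k. ptrace_B k b Y $$ (i, i)) = (\<Sum>i<k * b. Y $$ (i, i))"
  by (simp add: sum_lessThan_mult ptrace_B_def)

definition evolve :: "nat \<Rightarrow> nat \<Rightarrow> complex mat \<Rightarrow> complex mat \<Rightarrow> complex mat" where
  "evolve k b U Y = ptrace_B k b (U * Y * conj_tr U)"

lemma evolve_carrier [simp]: "evolve k b U Y \<in> carrier_mat k k"
  by (simp add: evolve_def ptrace_B_def)

lemma psd_mat_evolve:
  "U \<in> carrier_mat (k * b) (k * b) \<Longrightarrow> psd_mat (k * b) Y \<Longrightarrow> psd_mat k (evolve k b U Y)"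
  by (simp add: evolve_def psd_mat_ptrace_B psd_mat_conj)

lemma trace_evolve:
  "unitary_mat (k * b) U \<Longrightarrow> Y \<in> carrier_mat (k * b) (k * b) \<Longrightarrow>
    (\<Sum>i<k. evolve k b U Y $$ (i, i)) = (\<Sum>i<k * b. Y $$ (i, i))"
  by (simp add: evolve_def trace_ptrace_B trace_conj)

lemma evolve_one:
  assumes "unitary_mat (k * b) U" "i < k" "j < k"
  shows "evolve k b U (1\<^sub>m (k * b)) $$ (i, j) = (if i = j then of_nat b else 0)"
proof -
  have "U * 1\<^sub>m (k * b) * conj_tr U = 1\<^sub>m (k * b)"
    using assms(1) by (simp add: unitary_mat_def right_mult_one_mat[OF unitary_mat_carrier[OF assms(1)]])
  then have "evolve k b U (1\<^sub>m (k * b)) $$ (i, j) = (\<Sum>\<beta><b. if i = j then 1 else 0)"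
    using assms by (auto simp: evolve_def ptrace_B_def mult_add_less intro!: sum.cong)
  then show ?thesis by simp
qed

lemma evolve_lincomb:
  assumes U: "U \<in> carrier_mat (k * b) (k * b)" and c: "X \<in> carrier_mat (k * b) (k * b)" "Y \<in> carrier_mat (k * b) (k * b)"
      "Z \<in> carrier_mat (k * b) (k * b)"
    and Z: "\<And>i j. i < k * b \<Longrightarrow> j < k * b \<Longrightarrow> Z $$ (i, j) = s * X $$ (i, j) + t * Y $$ (i, j)"
    and ij: "i < k" "j < k"
  shows "evolve k b U Z $$ (i, j) = s * evolve k b U X $$ (i, j) + t * evolve k b U Y $$ (i, j)"
proof -
  have "(U * Z * conj_tr U) $$ (i, j) = s * (U * X * conj_tr U) $$ (i, j) + t * (U * Y * conj_tr U) $$ (i, j)"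
    if "i < k * b" "j < k * b" for i j
  proof -
    have "(U * Z * conj_tr U) $$ (i, j) = (\<Sum>m<k * b. \<Sum>l<k * b. s * (U $$ (i, m) * X $$ (m, l) * cnj (U $$ (j, l)))
        + t * (U $$ (i, m) * Y $$ (m, l) * cnj (U $$ (j, l))))"
      unfolding conj_mat_index[OF U c(3) that] by (intro sum.cong refl) (simp add: Z algebra_simps)
    then show ?thesis
      unfolding conj_mat_index[OF U c(1) that] conj_mat_index[OF U c(2) that]
      by (simp add: sum.distrib sum_distrib_left)
  qed
  then show ?thesis
    using ij by (simp add: evolve_def ptrace_B_def mult_add_less sum.distrib sum_distrib_left del: index_mult_mat)
qed

lemma diagonalizes_N_B:
  assumes W: "diagonalizes k (ptrace_B k b Y) W d" and b: "0 < b"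
  shows "diagonalizes (k * b) (N_B k b Y)
    (mat (k * b) (k * b) (\<lambda>(i, j). if i mod b = j mod b then W $$ (i div b, j div b) else 0))
    (\<lambda>i. d (i div b) * (1 / real b))" (is "diagonalizes ?n _ ?W ?d")
proof (rule diagonalizesI)
  have uW: "unitary_mat k W" using W by (simp add: diagonalizes_def)
  show "N_B k b Y \<in> carrier_mat ?n ?n" by (simp add: N_B_def)
  have div: "i div b < k" if "i < ?n" for i using that by (simp add: less_mult_imp_div_less)
  have Wi: "?W $$ (i * b + \<beta>, j) = (if \<beta> = j mod b then W $$ (i, j div b) else 0)"
      "?W $$ (j, i * b + \<beta>) = (if \<beta> = j mod b then W $$ (j div b, i) else 0)"
    if "i < k" "\<beta> < b" "j < ?n" for i j \<beta>
    using that by (auto simp: mult_add_less)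
  show "unitary_mat ?n ?W"
  proof (rule unitary_matI)
    fix i j assume ij: "i < ?n" "j < ?n"
    have "(\<Sum>m<?n. cnj (?W $$ (m, i)) * ?W $$ (m, j))
        = (\<Sum>m<k. \<Sum>\<beta><b. if \<beta> = i mod b then (if i mod b = j mod b then cnj (W $$ (m, i div b)) * W $$ (m, j div b) else 0) else 0)"
      unfolding sum_lessThan_mult using ij by (intro sum.cong refl) (simp add: Wi)
    also have "\<dots> = (if i mod b = j mod b then \<Sum>m<k. cnj (W $$ (m, i div b)) * W $$ (m, j div b) else 0)"
      using b by simp
    also have "\<dots> = (if i mod b = j mod b \<and> i div b = j div b then 1 else 0)"
      using unitary_mat_cols[OF uW div[OF ij(1)] div[OF ij(2)]] by auto
    also have "\<dots> = (if i = j then 1 else 0)"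
      by (metis mod_div_mult_eq)
    finally show "(\<Sum>m<?n. cnj (?W $$ (m, i)) * ?W $$ (m, j)) = (if i = j then 1 else 0)" .
  qed simp
  fix i j assume ij: "i < ?n" "j < ?n"
  have "(\<Sum>l<?n. ?W $$ (i, l) * complex_of_real (?d l) * cnj (?W $$ (j, l)))
    = (\<Sum>l<k. \<Sum>\<beta><b. if \<beta> = i mod b then (if i mod b = j mod b then
         W $$ (i div b, l) * complex_of_real (d l) * cnj (W $$ (j div b, l)) / of_nat b else 0) else 0)"
    unfolding sum_lessThan_mult using ij by (intro sum.cong refl) (simp add: Wi)
  also have "\<dots> = (if i mod b = j mod b then (\<Sum>l<k. W $$ (i div b, l) * complex_of_real (d l) * cnj (W $$ (j div b, l))) / of_nat b else 0)"
    using b by (simp add: sum_divide_distrib)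
  also have "\<dots> = N_B k b Y $$ (i, j)"
    using ij diagonalizes_index[OF W div[OF ij(1)] div[OF ij(2)]] by (simp add: N_B_def)
  finally show "N_B k b Y $$ (i, j) = (\<Sum>l<?n. ?W $$ (i, l) * complex_of_real (?d l) * cnj (?W $$ (j, l)))"
    by simp
qed

lemma unitary_mat_one: "unitary_mat n (1\<^sub>m n)"
  by (rule unitary_matI) (auto simp: if_distrib cong: if_cong)

lemma diagonalizes_diag_of: "diagonalizes n (diag_of n d) (1\<^sub>m n) d"
proof (rule diagonalizesI[OF diag_of_carrier unitary_mat_one])
  fix i j assume "i < n" "j < n"
  then have "(\<Sum>l<n. 1\<^sub>m n $$ (i, l) * complex_of_real (d l) * cnj (1\<^sub>m n $$ (j, l)))
     = (\<Sum>l<n. if l = i then (if i = j then complex_of_real (d i) else 0) else 0)"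
    by (intro sum.cong) auto
  then show "diag_of n d $$ (i, j) = (\<Sum>l<n. 1\<^sub>m n $$ (i, l) * complex_of_real (d l) * cnj (1\<^sub>m n $$ (j, l)))"
    using \<open>i < n\<close> \<open>j < n\<close> by (simp add: diag_of_def)
qed

lemma psd_mat_diag_of: "(\<And>i. i < n \<Longrightarrow> 0 \<le> d i) \<Longrightarrow> psd_mat n (diag_of n d)"
  unfolding psd_mat_def diagonalizes_quad[OF diagonalizes_diag_of]
  by (auto intro!: hermitian_matI sum_nonneg simp: diag_of_def)

lemma schatten_diag_of: "(\<And>i. i < n \<Longrightarrow> 0 \<le> d i) \<Longrightarrow> schatten p (diag_of n d) = lp_norm p n d"
  by (rule schatten_diagonalizes[OF diagonalizes_diag_of])

lemma schatten_scaled_one: "schatten p ((1 / of_nat b) \<cdot>\<^sub>m 1\<^sub>m b) = lp_norm p b (\<lambda>_. 1 / real b)"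
proof -
  have "(1 / of_nat b) \<cdot>\<^sub>m 1\<^sub>m b = diag_of b (\<lambda>_. 1 / real b)"
    by (rule eq_matI) (auto simp: diag_of_def)
  then show ?thesis by (simp add: schatten_diag_of)
qed

lemma schatten_N_B:
  assumes "1 \<le> p" "0 < b" "psd_mat k (ptrace_B k b Y)"
  shows "schatten p (N_B k b Y) = schatten p (ptrace_B k b Y) * schatten p ((1 / of_nat b) \<cdot>\<^sub>m 1\<^sub>m b)"
proof -
  obtain W d where W: "diagonalizes k (ptrace_B k b Y) W d" and d: "\<And>l. l < k \<Longrightarrow> 0 \<le> d l"
    using psd_mat_diagonalizable[OF assms(3)] by blast
  have "schatten p (N_B k b Y) = lp_norm p (k * b) (\<lambda>i. d (i div b) * (1 / real b))"
    using d by (intro schatten_diagonalizes[OF diagonalizes_N_B[OF W \<open>0 < b\<close>]]) (simp add: less_mult_imp_div_less)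
  also have "\<dots> = lp_norm p k d * lp_norm p b (\<lambda>_. 1 / real b)"
    using assms d by (intro lp_norm_tensor_const) auto
  finally show ?thesis by (simp only: schatten_scaled_one schatten_diagonalizes[OF W d])
qed

lemma density_op_iff: "density_op n \<rho> \<longleftrightarrow> psd_mat n \<rho> \<and> (\<Sum>i<n. \<rho> $$ (i, i)) = 1"
proof -
  have q: "(\<Sum>i<n. cnj (v $ i) * (\<rho> *\<^sub>v v) $ i) = quad n \<rho> (\<lambda>i. v $ i)"
    if "\<rho> \<in> carrier_mat n n" "v \<in> carrier_vec n" for v
    using that by (simp add: quad_def scalar_prod_def lessThan_atLeast0 sum_distrib_left mult_ac)
  have herm: "conj_tr \<rho> = \<rho> \<longleftrightarrow> hermitian_mat n \<rho>" if c: "\<rho> \<in> carrier_mat n n"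
  proof
    assume "conj_tr \<rho> = \<rho>"
    then show "hermitian_mat n \<rho>" using conj_tr_index[OF c] by (intro hermitian_matI c) metis
  next
    assume h: "hermitian_mat n \<rho>"
    show "conj_tr \<rho> = \<rho>"
      using c by (intro eq_matI) (auto simp: conj_tr_index[OF c] hermitian_mat_cnj[OF h])
  qed
  have all: "(\<forall>v\<in>carrier_vec n. 0 \<le> Re (quad n \<rho> (\<lambda>i. v $ i))) \<longleftrightarrow> (\<forall>v. 0 \<le> Re (quad n \<rho> v))"
  proof
    assume *: "\<forall>v\<in>carrier_vec n. 0 \<le> Re (quad n \<rho> (\<lambda>i. v $ i))"
    show "\<forall>v. 0 \<le> Re (quad n \<rho> v)"
    proof
      fix v
      have "quad n \<rho> (\<lambda>i. vec n v $ i) = quad n \<rho> v" by (simp add: quad_def)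
      then show "0 \<le> Re (quad n \<rho> v)" using * by (metis vec_carrier)
    qed
  qed auto
  show ?thesis
  proof (cases "\<rho> \<in> carrier_mat n n")
    case True
    have "(\<forall>v\<in>carrier_vec n. 0 \<le> Re (\<Sum>i<n. cnj (v $ i) * (\<rho> *\<^sub>v v) $ i)) \<longleftrightarrow> (\<forall>v. 0 \<le> Re (quad n \<rho> v))"
      unfolding all[symmetric] by (intro ball_cong refl) (simp only: q[OF True])
    with True show ?thesis unfolding density_op_def herm[OF True] psd_mat_def by simp
  next
    case False
    then show ?thesis using psd_mat_carrier by (auto simp: density_op_def)
  qed
qed

subsection \<open>The Weyl twirl\<close>

lemma sum_lessThan_add:
  fixes f :: "nat \<Rightarrow> 'a::comm_monoid_add"
  shows "(\<Sum>i<h + e. f i) = (\<Sum>i<h. f i) + (\<Sum>i<e. f (h + i))"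
  by (induction e) (simp_all add: add.assoc)

lemma sum_sum_delta:
  fixes f :: "nat \<Rightarrow> nat \<Rightarrow> 'a::comm_monoid_add"
  assumes "i < n" "j < n"
  shows "(\<Sum>k<n. \<Sum>l<n. if k = i \<and> l = j then f k l else 0) = f i j"
proof -
  have "(\<Sum>l<n. if k = i \<and> l = j then f k l else 0) = (if k = i then f k j else 0)" for k
    using assms by (cases "k = i") simp_all
  then show ?thesis using assms by simp
qed

lemma shiftX_pow_index:
  assumes "i < e" "j < e"
  shows "(shiftX e ^\<^sub>m x) $$ (i, j) = (if i = (j + x) mod e then 1 else 0)"
  using assms
proof (induction x arbitrary: i j)
  case 0
  then show ?case by (simp add: shiftX_def)
next
  case (Suc x)
  have c: "shiftX e \<in> carrier_mat e e" by (simp add: shiftX_def)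
  have l: "Suc j mod e < e" using Suc.prems by simp
  have "(shiftX e ^\<^sub>m Suc x) $$ (i, j) = (\<Sum>m<e. (shiftX e ^\<^sub>m x) $$ (i, m) * shiftX e $$ (m, j))"
    using Suc.prems by (simp add: mult_mat_index_sum[OF pow_carrier_mat[OF c] c] del: index_mult_mat)
  also have "\<dots> = (\<Sum>m<e. if m = Suc j mod e then (shiftX e ^\<^sub>m x) $$ (i, m) else 0)"
    using Suc.prems by (intro sum.cong refl) (auto simp: shiftX_def)
  also have "\<dots> = (if i = (Suc j mod e + x) mod e then 1 else 0)"
    using l Suc.IH[OF Suc.prems(1) l] by simp
  finally show ?case by (simp add: mod_add_left_eq)
qed

definition root_unity :: "nat \<Rightarrow> nat \<Rightarrow> complex" where
  "root_unity e j = exp (2 * pi * \<i> * of_nat j / of_nat e)"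

lemma root_unity_cis: "root_unity e j = cis (2 * pi * real j / real e)"
  by (simp add: root_unity_def cis_conv_exp mult_ac)

lemma clockZ_pow_index:
  assumes "i < e" "j < e"
  shows "(clockZ e ^\<^sub>m z) $$ (i, j) = (if i = j then root_unity e j ^ z else 0)"
  using assms
proof (induction z arbitrary: i j)
  case 0
  then show ?case by (simp add: clockZ_def)
next
  case (Suc z)
  have c: "clockZ e \<in> carrier_mat e e" by (simp add: clockZ_def)
  have "(clockZ e ^\<^sub>m Suc z) $$ (i, j) = (\<Sum>m<e. (clockZ e ^\<^sub>m z) $$ (i, m) * clockZ e $$ (m, j))"
    using Suc.prems by (simp add: mult_mat_index_sum[OF pow_carrier_mat[OF c] c] del: index_mult_mat)
  also have "\<dots> = (\<Sum>m<e. if m = j then (clockZ e ^\<^sub>m z) $$ (i, m) * root_unity e j else 0)"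
    using Suc.prems by (intro sum.cong refl) (auto simp: clockZ_def root_unity_def)
  finally show ?case using Suc.prems Suc.IH[OF Suc.prems] by simp
qed

lemma weyl_index:
  assumes "i < e" "j < e"
  shows "weyl e x z $$ (i, j) = (if i = (j + x) mod e then root_unity e j ^ z else 0)"
proof -
  have c: "shiftX e \<in> carrier_mat e e" "clockZ e \<in> carrier_mat e e" by (simp_all add: shiftX_def clockZ_def)
  have "weyl e x z $$ (i, j) = (\<Sum>m<e. (shiftX e ^\<^sub>m x) $$ (i, m) * (clockZ e ^\<^sub>m z) $$ (m, j))"
    unfolding weyl_def using assms
    by (simp add: mult_mat_index_sum[OF pow_carrier_mat[OF c(1)] pow_carrier_mat[OF c(2)]] del: index_mult_mat)
  also have "\<dots> = (\<Sum>m<e. if m = j then (shiftX e ^\<^sub>m x) $$ (i, m) * root_unity e j ^ z else 0)"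
    using assms by (intro sum.cong refl) (auto simp: clockZ_pow_index)
  finally show ?thesis using assms by (simp add: shiftX_pow_index)
qed

lemma root_unity_orthogonal:
  assumes "k < e" "l < e"
  shows "(\<Sum>z<e. root_unity e k ^ z * cnj (root_unity e l ^ z)) = (if k = l then of_nat e else 0)"
proof -
  let ?\<theta> = "2 * pi * (real k - real l) / real e"
  have e: "0 < real e" using assms by simp
  have "root_unity e k * cnj (root_unity e l) = cis ?\<theta>"
    by (simp add: root_unity_cis cis_cnj cis_mult diff_divide_distrib right_diff_distrib)
  then have "(\<Sum>z<e. root_unity e k ^ z * cnj (root_unity e l ^ z)) = (\<Sum>z<e. cis ?\<theta> ^ z)"
    by (simp flip: power_mult_distrib)
  also have "\<dots> = (if k = l then of_nat e else 0)"
  proof (cases "k = l")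
    case False
    have "cis ?\<theta> \<noteq> 1"
    proof
      assume "cis ?\<theta> = 1"
      then have "cos ?\<theta> = 1" by (simp add: complex_eq_iff)
      then obtain m :: int where "?\<theta> = of_int m * 2 * pi"
        using cos_one_2pi_int[of ?\<theta>] by blast
      then have "2 * pi * ((real k - real l) / real e) = 2 * pi * of_int m"
        by (simp only: times_divide_eq_right mult_ac)
      then have "(real k - real l) / real e = of_int m"
        by (subst (asm) mult_left_cancel) simp_all
      then have "real k - real l = of_int m * real e" using e by (simp add: nonzero_divide_eq_eq)
      then have "of_int (int k - int l) = (of_int (m * int e) :: real)" by simp
      then have eq: "int k - int l = m * int e" unfolding of_int_eq_iff .
      have "\<bar>m * int e\<bar> < int e" using assms unfolding eq[symmetric] by linarith
      then have "\<bar>m\<bar> * int e < 1 * int e" by (simp add: abs_mult)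
      then have "\<bar>m\<bar> < 1" by (rule mult_right_less_imp_less) simp
      then have "m = 0" by simp
      then show False using eq False by simp
    qed
    moreover have "cis ?\<theta> ^ e = 1"
    proof -
      have "real e * ?\<theta> = 2 * pi * of_int (int k - int l)" using e by simp
      then have "cis ?\<theta> ^ e = cis (2 * pi * of_int (int k - int l))" by (simp only: DeMoivre)
      also have "\<dots> = 1" by (rule cis_multiple_2pi) (rule Ints_of_int)
      finally show ?thesis .
    qed
    ultimately show ?thesis using False by (simp add: geometric_sum)
  qed simp
  finally show ?thesis .
qed

lemma card_shift:
  fixes e :: nat
  assumes "i < e" "k < e"
  shows "(\<Sum>x<e. if i = (k + x) mod e then 1 else 0) = (1::complex)"
proof -
  have "(i = (k + x) mod e) = (x = (i + (e - k)) mod e)" if "x < e" for x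
  proof
    assume "i = (k + x) mod e"
    then have "(i + (e - k)) mod e = (k + x + (e - k)) mod e" by (simp add: mod_add_left_eq)
    also have "k + x + (e - k) = x + e" using assms by simp
    finally show "x = (i + (e - k)) mod e" using that by simp
  next
    assume "x = (i + (e - k)) mod e"
    then have "(k + x) mod e = (k + (i + (e - k))) mod e" by (simp add: mod_add_right_eq)
    also have "k + (i + (e - k)) = i + e" using assms by simp
    finally show "i = (k + x) mod e" using assms by simp
  qed
  then have "(\<Sum>x<e. if i = (k + x) mod e then 1 else 0) = (\<Sum>x<e. if x = (i + (e - k)) mod e then 1 else (0::complex))"
    by (intro sum.cong refl) auto
  then show ?thesis using assms by simp
qed

lemma weyl_twirl:
  assumes "i < e" "j < e" "k < e" "l < e"
  shows "(\<Sum>x<e. \<Sum>z<e. weyl e x z $$ (i, k) * cnj (weyl e x z $$ (j, l)))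
    = (if i = j \<and> k = l then of_nat e else 0)"
proof -
  have "(\<Sum>x<e. \<Sum>z<e. weyl e x z $$ (i, k) * cnj (weyl e x z $$ (j, l)))
      = (\<Sum>x<e. (if i = (k + x) mod e then (if j = (l + x) mod e then 1 else 0) else 0)
          * (\<Sum>z<e. root_unity e k ^ z * cnj (root_unity e l ^ z)))"
    using assms by (intro sum.cong refl) (auto simp: weyl_index)
  also have "\<dots> = (if i = j \<and> k = l then of_nat e * (\<Sum>x<e. if i = (k + x) mod e then 1 else 0) else 0)"
    unfolding root_unity_orthogonal[OF assms(3,4)]
    by (auto simp: sum_distrib_left intro!: sum.cong sum.neutral)
  finally show ?thesis using assms by (simp add: card_shift)
qed

lemma D_S0_index:
  assumes "\<rho> \<in> carrier_mat (a * h) (a * h)" "i < a * h" "j < a * h"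
  shows "D_S0 a h \<rho> $$ (i, j) = (if (i < h) = (j < h) then \<rho> $$ (i, j) else 0)"
proof -
  let ?n = "a * h" and ?s = "\<lambda>i. if i < h then 1 else - 1 :: complex"
  have V: "V_refl a h \<in> carrier_mat ?n ?n" by (simp add: V_refl_def)
  have "(V_refl a h * \<rho> * conj_tr (V_refl a h)) $$ (i, j)
    = (\<Sum>k<?n. \<Sum>l<?n. if k = i \<and> l = j then ?s i * \<rho> $$ (k, l) * ?s j else 0)"
    unfolding conj_mat_index[OF V assms] using assms
    by (intro sum.cong refl) (auto simp: V_refl_def)
  also have "\<dots> = ?s i * \<rho> $$ (i, j) * ?s j" using assms by (simp only: sum_sum_delta)
  finally show ?thesis
    using assms V by (auto simp: D_S0_def simp del: index_mult_mat(1))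
qed

lemma blockW_carrier [simp]: "blockW a h x z \<in> carrier_mat (a * h) (a * h)"
  by (simp add: blockW_def Let_def)

lemma M_twirl_index:
  assumes \<rho>: "\<rho> \<in> carrier_mat (a * h) (a * h)" and n: "a * h = h + e" and e: "0 < e"
    and block: "\<And>i j. i < a * h \<Longrightarrow> j < a * h \<Longrightarrow> (i < h) \<noteq> (j < h) \<Longrightarrow> \<rho> $$ (i, j) = 0"
    and ij: "i < a * h" "j < a * h"
  shows "M_twirl a h \<rho> $$ (i, j) = (if i < h \<and> j < h then \<rho> $$ (i, j)
    else if i = j then (\<Sum>l<e. \<rho> $$ (h + l, h + l)) / of_nat e else 0)"
proof -
  let ?n = "a * h"
  let ?W = "blockW a h"
  have e': "?n - h = e" using n by simp
  have M: "M_twirl a h \<rho> $$ (i, j) = (\<Sum>x<e. \<Sum>z<e. (?W x z * \<rho> * conj_tr (?W x z)) $$ (i, j)) / (of_nat e * of_nat e)"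
    using ij by (simp add: M_twirl_def e' Let_def power2_eq_square)
  have W: "?W x z $$ (i, k) = (if i < h \<and> k < h then (if i = k then 1 else 0)
     else if h \<le> i \<and> h \<le> k then weyl e x z $$ (i - h, k - h) else 0)" if "i < ?n" "k < ?n" for x z i k
    using that by (simp add: blockW_def e' Let_def)
  have entry: "(?W x z * \<rho> * conj_tr (?W x z)) $$ (i, j) = (\<Sum>k<?n. \<Sum>l<?n. ?W x z $$ (i, k) * \<rho> $$ (k, l) * cnj (?W x z $$ (j, l)))"
    for x z by (rule conj_mat_index[OF blockW_carrier \<rho> ij])
  show ?thesis
  proof (cases "(i < h) = (j < h)")
    case False
    have "(?W x z * \<rho> * conj_tr (?W x z)) $$ (i, j) = 0" for x z
      unfolding entry using False ij by (intro sum.neutral ballI) (auto simp: W block)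
    then show ?thesis using False unfolding M by auto
  next
    case True
    show ?thesis
    proof (cases "i < h")
      case i: True
      then have "(?W x z * \<rho> * conj_tr (?W x z)) $$ (i, j)
        = (\<Sum>k<?n. \<Sum>l<?n. if k = i \<and> l = j then \<rho> $$ (k, l) else 0)" for x z
        unfolding entry using True ij by (intro sum.cong refl) (auto simp: W)
      then have "(?W x z * \<rho> * conj_tr (?W x z)) $$ (i, j) = \<rho> $$ (i, j)" for x z
        using ij by (simp only: sum_sum_delta)
      then show ?thesis using True i e unfolding M by simp
    next
      case i: False
      define i' j' where "i' = i - h" and "j' = j - h"
      have i'j': "i = h + i'" "j = h + j'" "i' < e" "j' < e"
        using i True ij n by (auto simp: i'_def j'_def)
      have "(?W x z * \<rho> * conj_tr (?W x z)) $$ (i, j)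
        = (\<Sum>k<e. \<Sum>l<e. weyl e x z $$ (i', k) * cnj (weyl e x z $$ (j', l)) * \<rho> $$ (h + k, h + l))" for x z
      proof -
        have "(\<Sum>l<?n. ?W x z $$ (i, k) * \<rho> $$ (k, l) * cnj (?W x z $$ (j, l))) = 0" if "k < h" for k
          using that i ij n by (intro sum.neutral ballI) (auto simp: W)
        moreover have "(\<Sum>l<?n. ?W x z $$ (i, h + k) * \<rho> $$ (h + k, l) * cnj (?W x z $$ (j, l)))
           = (\<Sum>l<e. weyl e x z $$ (i', k) * cnj (weyl e x z $$ (j', l)) * \<rho> $$ (h + k, h + l))" if "k < e" for k
        proof -
          have "?W x z $$ (j, l) = 0" if "l < h" for l using that i True ij n by (simp add: W)
          moreover have "?W x z $$ (j, h + l) = weyl e x z $$ (j', l)" "?W x z $$ (i, h + l) = weyl e x z $$ (i', l)" if "l < e" for l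
            using that i True ij n i'j' by (simp_all add: W)
          ultimately show ?thesis unfolding n sum_lessThan_add using that by (simp add: mult_ac)
        qed
        ultimately show ?thesis unfolding entry by (subst (1) n) (simp add: sum_lessThan_add)
      qed
      then have "(\<Sum>x<e. \<Sum>z<e. (?W x z * \<rho> * conj_tr (?W x z)) $$ (i, j))
        = (\<Sum>x<e. \<Sum>z<e. \<Sum>k<e. \<Sum>l<e. weyl e x z $$ (i', k) * cnj (weyl e x z $$ (j', l)) * \<rho> $$ (h + k, h + l))"
        by simp
      also have "\<dots> = (\<Sum>k<e. \<Sum>l<e. \<Sum>x<e. \<Sum>z<e. weyl e x z $$ (i', k) * cnj (weyl e x z $$ (j', l)) * \<rho> $$ (h + k, h + l))"
        by (rule sum_swap4)
      also have "\<dots> = (\<Sum>k<e. \<Sum>l<e. (\<Sum>x<e. \<Sum>z<e. weyl e x z $$ (i', k) * cnj (weyl e x z $$ (j', l))) * \<rho> $$ (h + k, h + l))"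
        by (simp add: sum_distrib_right)
      also have "\<dots> = (\<Sum>k<e. \<Sum>l<e. if l = k then (if i' = j' then of_nat e * \<rho> $$ (h + k, h + l) else 0) else 0)"
        using i'j' by (intro sum.cong refl) (auto simp: weyl_twirl)
      also have "\<dots> = (if i = j then of_nat e * (\<Sum>k<e. \<rho> $$ (h + k, h + k)) else 0)"
        using i'j' by (simp add: sum_distrib_left)
      finally show ?thesis using i e unfolding M by simp
    qed
  qed
qed

lemma twirled_index:
  assumes \<rho>: "\<rho> \<in> carrier_mat (a * h) (a * h)" and n: "a * h = h + e" and e: "0 < e"
    and ij: "i < a * h" "j < a * h"
  shows "M_twirl a h (D_S0 a h \<rho>) $$ (i, j) = (if i < h \<and> j < h then \<rho> $$ (i, j)
    else if i = j then (\<Sum>l<e. \<rho> $$ (h + l, h + l)) / of_nat e else 0)"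
proof -
  have "D_S0 a h \<rho> \<in> carrier_mat (a * h) (a * h)"
    using \<rho> by (simp add: D_S0_def V_refl_def)
  from M_twirl_index[OF this n e _ ij] show ?thesis
    using ij by (simp add: D_S0_index[OF \<rho>] n)
qed

lemma M_twirl_carrier [simp]: "M_twirl a h \<rho> \<in> carrier_mat (a * h) (a * h)"
  by (simp add: M_twirl_def Let_def)

lemma quad_embed0:
  assumes "h \<le> a * h"
  shows "quad (a * h) (embed0 a h X) v = quad h X v"
proof -
  obtain e where n: "a * h = h + e" using assms le_Suc_ex by blast
  show ?thesis unfolding quad_def embed0_def n sum_lessThan_add by simp
qed

lemma psd_mat_embed0:
  assumes "h \<le> a * h" "psd_mat h X"
  shows "psd_mat (a * h) (embed0 a h X)"
proof -
  have "hermitian_mat h X" using assms by (simp add: psd_mat_def)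
  then have "hermitian_mat (a * h) (embed0 a h X)"
    by (intro hermitian_matI) (auto simp: embed0_def hermitian_mat_cnj)
  then show ?thesis using assms by (simp add: psd_mat_def quad_embed0)
qed

lemma trace_embed0:
  assumes "h \<le> a * h"
  shows "(\<Sum>i<a * h. embed0 a h X $$ (i, i)) = (\<Sum>i<h. X $$ (i, i))"
proof -
  obtain e where n: "a * h = h + e" using assms le_Suc_ex by blast
  show ?thesis unfolding embed0_def n sum_lessThan_add by simp
qed

lemma embed0_carrier [simp]: "embed0 a h X \<in> carrier_mat (a * h) (a * h)"
  by (simp add: embed0_def)

lemma psd_mat_diagonal:
  assumes "psd_mat n A" "i < n"
  shows "0 \<le> Re (A $$ (i, i))" "A $$ (i, i) = complex_of_real (Re (A $$ (i, i)))"
proof -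
  have "quad n A (\<lambda>j. if j = i then 1 else 0) = (\<Sum>k<n. \<Sum>l<n. if k = i \<and> l = i then A $$ (k, l) else 0)"
    unfolding quad_def by (intro sum.cong refl) auto
  also have "\<dots> = A $$ (i, i)" using assms by (simp only: sum_sum_delta)
  finally show "0 \<le> Re (A $$ (i, i))" using assms unfolding psd_mat_def by metis
  have "cnj (A $$ (i, i)) = A $$ (i, i)" using assms by (simp add: psd_mat_def hermitian_mat_cnj[of n])
  then show "A $$ (i, i) = complex_of_real (Re (A $$ (i, i)))" by (simp add: complex_eq_iff)
qed

definition mixed_perp :: "nat \<Rightarrow> nat \<Rightarrow> nat \<Rightarrow> complex mat" where
  "mixed_perp n h e = diag_of n (\<lambda>i. if i < h then 0 else 1 / real e)"

lemma density_op_exists: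
  assumes "0 < n"
  shows "density_op n (diag_of n (\<lambda>_. 1 / real n))"
  using assms by (simp add: density_op_iff psd_mat_diag_of) (simp add: diag_of_def)

lemma twirled_decomposition:
  assumes \<rho>: "density_op (a * h) \<rho>" and n: "a * h = h + e" and e: "0 < e" and h: "0 < h"
  obtains \<sigma> q where "density_op h \<sigma>" "0 \<le> q" "q \<le> 1"
    "\<forall>i<a * h. \<forall>j<a * h. M_twirl a h (D_S0 a h \<rho>) $$ (i, j)
      = complex_of_real (1 - q) * embed0 a h \<sigma> $$ (i, j) + complex_of_real q * mixed_perp (a * h) h e $$ (i, j)"
proof -
  have psd: "psd_mat (a * h) \<rho>" and tr: "(\<Sum>i<a * h. \<rho> $$ (i, i)) = 1" using \<rho> by (auto simp: density_op_iff)
  note c = psd_mat_carrier[OF psd]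
  have herm: "hermitian_mat (a * h) \<rho>" using psd by (simp add: psd_mat_def)
  define q where "q = (\<Sum>l<e. Re (\<rho> $$ (h + l, h + l)))"
  have ql: "(\<Sum>l<e. \<rho> $$ (h + l, h + l)) = complex_of_real q"
    unfolding q_def of_real_sum using psd_mat_diagonal(2)[OF psd] n by (intro sum.cong refl) simp
  have q0: "0 \<le> q" unfolding q_def using psd_mat_diagonal(1)[OF psd] n by (intro sum_nonneg) simp
  define \<rho>0 where "\<rho>0 = mat h h (\<lambda>(i, j). \<rho> $$ (i, j))"
  have "quad h \<rho>0 v = quad (a * h) \<rho> (\<lambda>i. if i < h then v i else 0)" for v
    unfolding quad_def n sum_lessThan_add by (simp add: \<rho>0_def)
  moreover have "hermitian_mat h \<rho>0"
    by (rule hermitian_matI) (simp_all add: \<rho>0_def hermitian_mat_cnj[OF herm] n)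
  ultimately have psd0: "psd_mat h \<rho>0" using psd by (simp add: psd_mat_def)
  have "(\<Sum>i<h. \<rho>0 $$ (i, i)) + complex_of_real q = 1"
    using tr unfolding n sum_lessThan_add ql by (simp add: \<rho>0_def)
  then have tr0: "(\<Sum>i<h. \<rho>0 $$ (i, i)) = complex_of_real (1 - q)" by (simp add: algebra_simps)
  have "0 \<le> (\<Sum>i<h. Re (\<rho>0 $$ (i, i)))" by (intro sum_nonneg psd_mat_diagonal(1)[OF psd0]) simp
  also have "\<dots> = 1 - q" using arg_cong[OF tr0, of Re] by simp
  finally have q1: "q \<le> 1" by simp
  obtain \<sigma> where \<sigma>: "density_op h \<sigma>" "\<And>i j. i < h \<Longrightarrow> j < h \<Longrightarrow> \<rho>0 $$ (i, j) = complex_of_real (1 - q) * \<sigma> $$ (i, j)"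
  proof (cases "q = 1")
    case True
    then show ?thesis
      using that[OF density_op_exists[OF h]] psd_mat_trace_zero[OF psd0] tr0 by simp
  next
    case False
    with q1 have q: "0 < 1 - q" by simp
    let ?\<sigma> = "mat h h (\<lambda>(i, j). complex_of_real (1 / (1 - q)) * \<rho>0 $$ (i, j))"
    have "psd_mat h ?\<sigma>"
      using q by (intro psd_mat_lincomb[OF psd0 psd0, of "1 / (1 - q)" 0]) auto
    moreover have "(\<Sum>i<h. ?\<sigma> $$ (i, i)) = complex_of_real (1 / (1 - q)) * complex_of_real (1 - q)"
      unfolding tr0[symmetric] sum_distrib_left by simp
    then have "(\<Sum>i<h. ?\<sigma> $$ (i, i)) = 1" using q by (simp flip: of_real_mult)
    ultimately have "density_op h ?\<sigma>" by (simp add: density_op_iff)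
    moreover have "\<rho>0 $$ (i, j) = complex_of_real (1 - q) * ?\<sigma> $$ (i, j)" if "i < h" "j < h" for i j
    proof -
      have "complex_of_real (1 - q) * complex_of_real (1 / (1 - q)) = 1"
        using q by (simp flip: of_real_mult)
      then show ?thesis using that by (simp add: mult.assoc[symmetric] del: of_real_diff of_real_divide)
    qed
    ultimately show ?thesis by (rule that)
  qed
  show ?thesis
  proof (rule that[OF \<sigma>(1) q0 q1], intro allI impI)
    fix i j assume ij: "i < a * h" "j < a * h"
    show "M_twirl a h (D_S0 a h \<rho>) $$ (i, j)
      = complex_of_real (1 - q) * embed0 a h \<sigma> $$ (i, j) + complex_of_real q * mixed_perp (a * h) h e $$ (i, j)"
      unfolding twirled_index[OF c n e ij] ql
      using ij \<sigma>(2)[of i j] by (auto simp: embed0_def mixed_perp_def diag_of_def \<rho>0_def simp del: of_real_diff)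
  qed
qed

lemma twirled_embed0:
  assumes X: "X \<in> carrier_mat h h" and n: "a * h = h + e" and e: "0 < e"
  shows "M_twirl a h (D_S0 a h (embed0 a h X)) = embed0 a h X"
proof (rule eq_matI)
  fix i j assume "i < dim_row (embed0 a h X)" "j < dim_col (embed0 a h X)"
  then have ij: "i < a * h" "j < a * h" by (auto simp: embed0_def)
  show "M_twirl a h (D_S0 a h (embed0 a h X)) $$ (i, j) = embed0 a h X $$ (i, j)"
    unfolding twirled_index[OF embed0_carrier n e ij] using ij n by (auto simp: embed0_def)
qed (simp_all add: M_twirl_def embed0_def Let_def)

subsection \<open>Comparison of the two channels\<close>

lemma schatten_scaled_one_pos:
  assumes "1 \<le> p" "0 < b"
  shows "0 < schatten p ((1 / of_nat b) \<cdot>\<^sub>m 1\<^sub>m b)"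
  unfolding schatten_scaled_one using \<open>1 \<le> p\<close>
proof (cases rule: ereal_ge_one_cases)
  case 1
  have "0 < 1 / real b" using assms by simp
  also have "\<dots> \<le> lp_norm \<infinity> b (\<lambda>_. 1 / real b)" using assms by (intro le_lp_norm_PInf[of 0 b "\<lambda>_. 1 / real b"])
  finally show "0 < lp_norm p b (\<lambda>_. 1 / real b)" using 1 by simp
next
  case (2 r)
  then show "0 < lp_norm p b (\<lambda>_. 1 / real b)" using assms by (simp add: lp_norm_ereal)
qed

lemma schatten_evolve_mixed_perp_le:
  assumes "1 \<le> p" and "0 < k" and U: "unitary_mat (k * b) U" and n: "k * b = h + e" and e: "0 < e"
  shows "schatten p (evolve k b U (mixed_perp (k * b) h e))
    \<le> real (k * b) / real e * lp_norm p k (\<lambda>_. 1 / real k)"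
proof -
  let ?n = "k * b" and ?E = "evolve k b U"
  note cU = unitary_mat_carrier[OF U]
  let ?P = "diag_of ?n (\<lambda>i. if i < h then 1 else 0)" and ?M = "mixed_perp ?n h e"
  have psdM: "psd_mat ?n ?M" unfolding mixed_perp_def by (rule psd_mat_diag_of) simp
  have psdP: "psd_mat ?n ?P" by (rule psd_mat_diag_of) simp
  have "Re (quad k (?E ?M) v) \<le> real b / real e" if v: "(\<Sum>j<k. (cmod (v j))\<^sup>2) = 1" for v
  proof -
    have one: "?E (1\<^sub>m ?n) $$ (i, j) = complex_of_real 1 * ?E ?P $$ (i, j) + complex_of_real (real e) * ?E ?M $$ (i, j)"
      if "i < k" "j < k" for i j
      using e by (intro evolve_lincomb[OF cU _ _ _ _ that])
        (auto simp: mixed_perp_def diag_of_def)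
    have "quad k (?E (1\<^sub>m ?n)) v = complex_of_real 1 * quad k (?E ?P) v + complex_of_real (real e) * quad k (?E ?M) v"
      by (rule quad_lincomb) (rule one)
    then have "Re (quad k (?E (1\<^sub>m ?n)) v) = Re (quad k (?E ?P) v) + real e * Re (quad k (?E ?M) v)" by simp
    moreover have "0 \<le> Re (quad k (?E ?P) v)"
      using psd_mat_evolve[OF cU psdP] by (simp add: psd_mat_def)
    moreover have "quad k (?E (1\<^sub>m ?n)) v = complex_of_real (real b)"
    proof -
      have "quad k (?E (1\<^sub>m ?n)) v = (\<Sum>i<k. \<Sum>j<k. if j = i then of_nat b * (v i * cnj (v j)) else 0)"
        unfolding quad_def by (intro sum.cong refl) (simp add: evolve_one[OF U])
      also have "\<dots> = of_nat b * complex_of_real (\<Sum>i<k. (cmod (v i))\<^sup>2)"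
        by (simp add: complex_norm_square sum_distrib_left del: of_real_power)
      finally show ?thesis by (simp add: v)
    qed
    ultimately have "real e * Re (quad k (?E ?M) v) \<le> real b" by simp
    then show ?thesis using e by (simp add: field_simps)
  qed
  then have "schatten p (?E ?M) \<le> lp_norm p k (\<lambda>_. real b / real e)"
    by (rule schatten_le_of_quad_le[OF \<open>1 \<le> p\<close> psd_mat_evolve[OF cU psdM]])
  also have "(\<lambda>_::nat. real b / real e) = (\<lambda>_. real ?n / real e * (1 / real k))"
    using \<open>0 < k\<close> by simp
  also have "lp_norm p k \<dots> = real ?n / real e * lp_norm p k (\<lambda>_. 1 / real k)"
    by (rule lp_norm_cmult[OF \<open>1 \<le> p\<close>]) auto
  finally show ?thesis .
qed

theorem theorem7p9:
  fixes a h k b :: nat and U :: "complex mat" and p :: ereal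
  assumes "2 \<le> a" and "1 \<le> h" and "1 \<le> k" and "1 \<le> b"
    and "a * h = k * b"
    and "unitary_mat (a * h) U"
    and "1 \<le> p"
  shows "nu p h (stine a h k b U)
           \<le> nu p (a * h) (Phi' a h k b U) / schatten p ((1 / of_nat b) \<cdot>\<^sub>m 1\<^sub>m b)
      \<and> nu p (a * h) (Phi' a h k b U) / schatten p ((1 / of_nat b) \<cdot>\<^sub>m 1\<^sub>m b)
           \<le> nu p h (stine a h k b U) + 2 * real b / real a"
proof -
  note ah = \<open>a * h = k * b\<close>
  define e where "e = (a - 1) * h"
  have n: "a * h = h + e" using assms(1) by (cases a) (auto simp: e_def)
  have e: "0 < e" using assms(1,2) by (simp add: e_def)
  have pos: "0 < h" "0 < k" "0 < b" using assms by auto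
  have U: "unitary_mat (k * b) U" using assms(6) ah by simp
  note cU = unitary_mat_carrier[OF U]
  let ?s = "schatten p ((1 / of_nat b) \<cdot>\<^sub>m 1\<^sub>m b)"
  let ?E = "evolve k b U" and ?C = "\<lambda>\<rho>. M_twirl a h (D_S0 a h \<rho>)"
  let ?M = "mixed_perp (k * b) h e"
  have s: "0 < ?s" by (rule schatten_scaled_one_pos[OF assms(7) pos(3)])
  have stine: "stine a h k b U X = ?E (embed0 a h X)" for X
    by (simp add: stine_def evolve_def)
  have psdM: "psd_mat (k * b) ?M" unfolding mixed_perp_def by (rule psd_mat_diag_of) simp

  have good: "psd_mat k (?E Y) \<and> (\<Sum>i<k. ?E Y $$ (i, i)) = 1" if "density_op (k * b) Y" for Y
    using that psd_mat_evolve[OF cU] trace_evolve[OF U psd_mat_carrier] by (auto simp: density_op_iff)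
  have dens_embed: "density_op (k * b) (embed0 a h X)" if "density_op h X" for X
    using that psd_mat_embed0[of h a X] trace_embed0[of h a X] n by (simp add: density_op_iff flip: ah)
  have dens_C: "density_op (k * b) (?C \<rho>)" if \<rho>: "density_op (a * h) \<rho>" for \<rho>
  proof -
    obtain \<sigma> q where \<sigma>: "density_op h \<sigma>" and q: "0 \<le> q" "q \<le> 1"
      and C: "\<forall>i<a * h. \<forall>j<a * h. ?C \<rho> $$ (i, j)
        = complex_of_real (1 - q) * embed0 a h \<sigma> $$ (i, j) + complex_of_real q * mixed_perp (a * h) h e $$ (i, j)"
      by (rule twirled_decomposition[OF \<rho> n e pos(1)])
    have "psd_mat (a * h) (?C \<rho>)"
    proof (rule psd_mat_lincomb[OF _ _ _ q(1) M_twirl_carrier C[rule_format]])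
      show "psd_mat (a * h) (embed0 a h \<sigma>)" using dens_embed[OF \<sigma>] ah by (simp only: density_op_iff)
      show "psd_mat (a * h) (mixed_perp (a * h) h e)" using psdM ah by (simp only:)
      show "0 \<le> 1 - q" using q by simp
    qed
    moreover have "(\<Sum>i<a * h. ?C \<rho> $$ (i, i)) = 1"
    proof -
      have "(\<Sum>i<a * h. mixed_perp (a * h) h e $$ (i, i)) = 1"
        using e unfolding n sum_lessThan_add by (simp add: mixed_perp_def diag_of_def)
      moreover have "(\<Sum>i<a * h. embed0 a h \<sigma> $$ (i, i)) = 1"
        using dens_embed[OF \<sigma>] ah by (simp add: density_op_iff)
      ultimately show ?thesis by (simp add: C sum.distrib flip: sum_distrib_left)
    qed
    ultimately show ?thesis using ah by (simp add: density_op_iff)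
  qed

  have Phi': "schatten p (Phi' a h k b U \<rho>) = schatten p (?E (?C \<rho>)) * ?s" if "density_op (a * h) \<rho>" for \<rho>
    using schatten_N_B[OF assms(7) pos(3), of k "U * ?C \<rho> * conj_tr U"] good[OF dens_C[OF that]]
    by (simp add: Phi'_def evolve_def)
  have E_le: "schatten p (?E (?C \<rho>)) \<le> 1" if "density_op (a * h) \<rho>" for \<rho>
    using good[OF dens_C[OF that]] schatten_bounds_trace_one(1)[OF assms(7) _ _ pos(2)] by blast
  let ?S = "(\<lambda>X. schatten p (stine a h k b U X)) ` {X. density_op h X}"
  let ?S' = "(\<lambda>\<rho>. schatten p (Phi' a h k b U \<rho>)) ` {\<rho>. density_op (a * h) \<rho>}"
  have ne: "?S \<noteq> {}" "?S' \<noteq> {}"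
    using density_op_exists[of h] density_op_exists[of "a * h"] pos e n by auto
  have bdd: "bdd_above ?S"
    using good[OF dens_embed] schatten_bounds_trace_one(1)[OF assms(7) _ _ pos(2)]
    by (intro bdd_aboveI[of _ 1]) (auto simp: stine)
  have bdd': "bdd_above ?S'"
    using s E_le by (intro bdd_aboveI[of _ ?s]) (auto simp: Phi')

  have "schatten p (stine a h k b U X) \<le> nu p (a * h) (Phi' a h k b U) / ?s" if X: "density_op h X" for X
  proof -
    have "X \<in> carrier_mat h h" using X by (simp add: density_op_def)
    then have "?C (embed0 a h X) = embed0 a h X" using n e by (rule twirled_embed0)
    then have "schatten p (stine a h k b U X) * ?s = schatten p (Phi' a h k b U (embed0 a h X))"
      using dens_embed[OF X] ah by (simp add: Phi' stine)
    also have "\<dots> \<le> nu p (a * h) (Phi' a h k b U)"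
      unfolding nu_def using dens_embed[OF X] ah by (intro cSup_upper bdd') auto
    finally show ?thesis using s by (simp add: field_simps)
  qed
  then have lower: "nu p h (stine a h k b U) \<le> nu p (a * h) (Phi' a h k b U) / ?s"
    unfolding nu_def[of p h] by (intro cSup_least ne) auto

  let ?\<nu> = "nu p h (stine a h k b U)" and ?u = "lp_norm p k (\<lambda>_. 1 / real k)"
  have le_nu: "schatten p (?E (embed0 a h X)) \<le> ?\<nu>" if "density_op h X" for X
    unfolding nu_def using that by (intro cSup_upper bdd) (auto simp: stine)
  have u: "?u \<le> ?\<nu>" "?u \<le> 1"
  proof -
    obtain X where X: "density_op h X" using density_op_exists[OF pos(1)] by blast
    have "?u \<le> schatten p (?E (embed0 a h X))"
      using good[OF dens_embed[OF X]] schatten_bounds_trace_one(2)[OF assms(7) _ _ pos(2)] by blast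
    then show "?u \<le> ?\<nu>" using le_nu[OF X] by linarith
    show "?u \<le> 1" using pos by (intro lp_norm_le_one assms(7)) auto
  qed
  have M_le: "schatten p (?E ?M) \<le> ?\<nu> + 2 * real b / real a"
  proof -
    have "schatten p (?E ?M) \<le> real (k * b) / real e * ?u"
      using n ah by (intro schatten_evolve_mixed_perp_le[OF assms(7) pos(2) U _ e]) auto
    also have "real (k * b) / real e = 1 + 1 / (real a - 1)"
    proof -
      have "real (k * b) = real a * real h" by (simp only: of_nat_mult flip: ah)
      moreover have "real e = (real a - 1) * real h" using assms(1) by (simp add: e_def of_nat_diff)
      ultimately have "real (k * b) / real e = real a / (real a - 1)" using pos by simp
      also have "\<dots> = 1 + 1 / (real a - 1)" using assms(1) by (simp add: field_simps)
      finally show ?thesis .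
    qed
    also have "(1 + 1 / (real a - 1)) * ?u = ?u + ?u / (real a - 1)" by (simp add: algebra_simps)
    also have "?u / (real a - 1) \<le> 1 / (real a - 1)"
      using assms(1) u(2) by (intro divide_right_mono) auto
    also have "1 / (real a - 1) \<le> 2 / real a" using assms(1) by (simp add: field_simps)
    also have "2 / real a \<le> 2 * real b / real a" using pos by (intro divide_right_mono) auto
    finally show ?thesis using u(1) by linarith
  qed
  have "schatten p (?E (?C \<rho>)) \<le> ?\<nu> + 2 * real b / real a" if \<rho>: "density_op (a * h) \<rho>" for \<rho>
  proof -
    obtain \<sigma> q where \<sigma>: "density_op h \<sigma>" and q: "0 \<le> q" "q \<le> 1"
      and C: "\<forall>i<a * h. \<forall>j<a * h. ?C \<rho> $$ (i, j)
        = complex_of_real (1 - q) * embed0 a h \<sigma> $$ (i, j) + complex_of_real q * mixed_perp (a * h) h e $$ (i, j)"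
      by (rule twirled_decomposition[OF \<rho> n e pos(1)])
    have "schatten p (?E (?C \<rho>)) \<le> max (schatten p (?E (embed0 a h \<sigma>))) (schatten p (?E ?M))"
    proof (rule schatten_quasiconvex[OF assms(7) _ psd_mat_evolve[OF cU psdM] q evolve_carrier])
      show "psd_mat k (?E (embed0 a h \<sigma>))" using good[OF dens_embed[OF \<sigma>]] by simp
      show "?E (?C \<rho>) $$ (i, j) = complex_of_real (1 - q) * ?E (embed0 a h \<sigma>) $$ (i, j) + complex_of_real q * ?E ?M $$ (i, j)"
        if "i < k" "j < k" for i j
      proof (rule evolve_lincomb[OF cU _ _ _ _ that])
        show "embed0 a h \<sigma> \<in> carrier_mat (k * b) (k * b)" "?C \<rho> \<in> carrier_mat (k * b) (k * b)"
          using embed0_carrier[of a h] M_twirl_carrier[of a h] unfolding ah by blast+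
        show "?M \<in> carrier_mat (k * b) (k * b)" by (simp add: mixed_perp_def)
        show "?C \<rho> $$ (i, j) = complex_of_real (1 - q) * embed0 a h \<sigma> $$ (i, j) + complex_of_real q * ?M $$ (i, j)"
          if "i < k * b" "j < k * b" for i j
          using C that unfolding ah by blast
      qed
    qed
    also have "\<dots> \<le> ?\<nu> + 2 * real b / real a"
    proof -
      have "0 \<le> 2 * real b / real a" by simp
      then show ?thesis using le_nu[OF \<sigma>] M_le by linarith
    qed
    finally show ?thesis .
  qed
  then have "schatten p (Phi' a h k b U \<rho>) \<le> (?\<nu> + 2 * real b / real a) * ?s" if "density_op (a * h) \<rho>" for \<rho>
    using that s by (simp add: Phi' mult_right_mono)
  then have "nu p (a * h) (Phi' a h k b U) \<le> (?\<nu> + 2 * real b / real a) * ?s"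
    unfolding nu_def[of p "a * h"] by (intro cSup_least ne) auto
  then have "nu p (a * h) (Phi' a h k b U) / ?s \<le> ?\<nu> + 2 * real b / real a"
    using s by (simp add: pos_divide_le_eq)
  with lower show ?thesis by blast
qed

end
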